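(* Let $X$ be a connected topological space and let $\mathcal H$ be a reproducing kernel Hilbert space on $X$ whose reproducing kernel $s$ is a normalized complete Pick kernel and is jointly continuous on $X\times X$. If $s$ is unbounded on $X \times X$, then there exists $\varphi\in\operatorname{Mult}(\mathcal H)$ such that the multiplication operator $M_\varphi$ on $\mathcal H$ is not essentially normal, i.e. $M_\varphi^*M_\varphi-M_\varphi M_\varphi^*$ is not compact.
   Context: A normalized complete Pick kernel on $X$ is a kernel of the form $s(z,w)=\frac{1}{1-\langle b(z),b(w)\rangle_{\mathcal K}}$, where $b$ is a function from $X$ into the open unit ball of some Hilbert space $\mathcal K$ and there is a point $w_0\in X$ with $b(w_0)=0$. $\operatorname{Mult}(\mathcal H)$ is the set of functions $\varphi$ on $X$ such that $\varphi f\in\mathcal H$ for all $f\in\mathcal H$, and $M_\varphi f=\varphi f$. *)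

theory Defs
  imports "HOL-Analysis.Analysis" "HOL-Library.Function_Algebras"
begin

text \<open>
  The libraries only provide real inner product spaces, so complex Hilbert spaces are introduced
  here. They are carried by a linear subspace \<open>V\<close> of an ambient complex vector space, so that
  Hilbert spaces of functions are covered: the values of \<open>ip\<close> matter on \<open>V\<close> only. Inner products
  are linear in the first and conjugate-linear in the second argument.
\<close>

locale complex_inner_product_space = vector_space scale
  for scale :: "complex \<Rightarrow> 'v::ab_group_add \<Rightarrow> 'v" +
  fixes V :: "'v set" and ip :: "'v \<Rightarrow> 'v \<Rightarrow> complex"
  assumes subspace_carrier: "subspace V"
    and ip_add_left: "\<lbrakk>x \<in> V; y \<in> V; z \<in> V\<rbrakk> \<Longrightarrow> ip (x + y) z = ip x z + ip y z"
    and ip_scale_left: "\<lbrakk>x \<in> V; y \<in> V\<rbrakk> \<Longrightarrow> ip (scale c x) y = c * ip x y"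
    and ip_commute: "\<lbrakk>x \<in> V; y \<in> V\<rbrakk> \<Longrightarrow> ip x y = cnj (ip y x)"
    and ip_pos: "\<lbrakk>x \<in> V; x \<noteq> 0\<rbrakk> \<Longrightarrow> 0 < Re (ip x x)"
begin

definition hnorm :: "'v \<Rightarrow> real" where
  "hnorm x = sqrt (Re (ip x x))"

text \<open>The value \<open>0\<close> off the carrier is needed because the library's locale \<open>Metric_space\<close> requires
  nonnegativity and symmetry on the whole type.\<close>

definition hdist :: "'v \<Rightarrow> 'v \<Rightarrow> real" where
  "hdist x y = (if x \<in> V \<and> y \<in> V then hnorm (x - y) else 0)"

lemma ip_zero_left: "y \<in> V \<Longrightarrow> ip 0 y = 0"
  using ip_scale_left[of y y 0] by simp

lemma ip_zero_right: "y \<in> V \<Longrightarrow> ip y 0 = 0"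
  using ip_zero_left[of y] ip_commute[of y 0] subspace_0[OF subspace_carrier] by simp

lemma ip_add_right: "\<lbrakk>x \<in> V; y \<in> V; z \<in> V\<rbrakk> \<Longrightarrow> ip x (y + z) = ip x y + ip x z"
  using ip_add_left[of y z x] ip_commute[of x "y + z"] ip_commute[of x y] ip_commute[of x z]
    subspace_add[OF subspace_carrier] by simp

lemma ip_scale_right: "\<lbrakk>x \<in> V; y \<in> V\<rbrakk> \<Longrightarrow> ip x (scale c y) = cnj c * ip x y"
  using ip_scale_left[of y x c] ip_commute[of x "scale c y"] ip_commute[of x y]
    subspace_scale[OF subspace_carrier] by simp

lemma ip_self_nonneg: "x \<in> V \<Longrightarrow> 0 \<le> Re (ip x x)"
  using ip_pos[of x] ip_zero_left[of x] by (cases "x = 0") auto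

lemma hnorm_nonneg: "x \<in> V \<Longrightarrow> 0 \<le> hnorm x"
  by (simp add: hnorm_def ip_self_nonneg)

lemma hnorm_power2: "x \<in> V \<Longrightarrow> (hnorm x)\<^sup>2 = Re (ip x x)"
  by (simp add: hnorm_def ip_self_nonneg)

lemma hnorm_eq_0_iff: "x \<in> V \<Longrightarrow> hnorm x = 0 \<longleftrightarrow> x = 0"
  using ip_pos[of x] ip_zero_left[of x] by (cases "x = 0") (auto simp: hnorm_def)

lemma hnorm_minus_commute:
  assumes "x \<in> V" "y \<in> V"
  shows "hnorm (x - y) = hnorm (y - x)"
proof -
  have d: "x - y \<in> V"
    using assms subspace_carrier by (rule_tac subspace_diff)
  have s: "scale (-1) (x - y) \<in> V"
    by (rule subspace_scale[OF subspace_carrier d])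
  have "y - x = scale (-1) (x - y)"
    by simp
  then have "ip (y - x) (y - x) = ip (x - y) (x - y)"
    using ip_scale_left[OF d s, of "-1"] ip_scale_right[OF d d, of "-1"] by simp
  then show ?thesis
    by (simp add: hnorm_def)
qed

lemma hnorm_power2_add:
  assumes "x \<in> V" "y \<in> V"
  shows "(hnorm (x + y))\<^sup>2 = (hnorm x)\<^sup>2 + 2 * Re (ip x y) + (hnorm y)\<^sup>2"
proof -
  have s: "x + y \<in> V"
    using assms subspace_add[OF subspace_carrier] by blast
  have "ip (x + y) (x + y) = ip x x + ip x y + (ip y x + ip y y)"
    using assms s by (simp add: ip_add_left ip_add_right)
  moreover have "Re (ip y x) = Re (ip x y)"
    using ip_commute[OF assms] by simp
  ultimately show ?thesis
    using assms s by (simp add: hnorm_power2)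
qed

lemma Re_ip_le:
  assumes x: "x \<in> V" and y: "y \<in> V"
  shows "Re (ip x y) \<le> hnorm x * hnorm y"
proof (cases "x = 0 \<or> y = 0")
  case True
  then show ?thesis
    using x y by (auto simp: ip_zero_left ip_zero_right hnorm_nonneg)
next
  case False
  let ?a = "hnorm x" and ?b = "hnorm y"
  let ?u = "scale (of_real ?b) x" and ?v = "scale (- of_real ?a) y"
  have ab: "0 < ?a" "0 < ?b"
    using False x y hnorm_nonneg hnorm_eq_0_iff by (metis less_eq_real_def)+
  have u: "?u \<in> V" and v: "?v \<in> V"
    using x y subspace_scale[OF subspace_carrier] by blast+
  have "(hnorm ?u)\<^sup>2 = ?b\<^sup>2 * ?a\<^sup>2" "(hnorm ?v)\<^sup>2 = ?a\<^sup>2 * ?b\<^sup>2"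
    using x y u v by (simp_all only: hnorm_power2 ip_scale_left ip_scale_right)
      (simp_all add: power2_eq_square flip: hnorm_power2)
  moreover have "Re (ip ?u ?v) = - (?a * ?b * Re (ip x y))"
    using x y v by (simp only: ip_scale_left ip_scale_right) simp
  ultimately have "0 \<le> ?b\<^sup>2 * ?a\<^sup>2 + 2 * - (?a * ?b * Re (ip x y)) + ?a\<^sup>2 * ?b\<^sup>2"
    using hnorm_power2_add[OF u v] zero_le_power2[of "hnorm (?u + ?v)"] by metis
  also have "\<dots> = 2 * (?a * ?b) * (?a * ?b - Re (ip x y))"
    by (simp add: algebra_simps power2_eq_square)
  finally have "0 \<le> 2 * (?a * ?b) * (?a * ?b - Re (ip x y))" .
  then show ?thesis
    using mult_pos_pos[OF ab] by (auto simp: zero_le_mult_iff[of "2 * (?a * ?b)"])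
qed

lemma hnorm_triangle:
  assumes "x \<in> V" "y \<in> V"
  shows "hnorm (x + y) \<le> hnorm x + hnorm y"
proof (rule power2_le_imp_le)
  show "(hnorm (x + y))\<^sup>2 \<le> (hnorm x + hnorm y)\<^sup>2"
    using Re_ip_le[OF assms] hnorm_power2_add[OF assms] by (simp add: power2_sum)
  show "0 \<le> hnorm x + hnorm y"
    using assms hnorm_nonneg by simp
qed

sublocale metric: Metric_space V hdist
proof
  note diff = subspace_diff[OF subspace_carrier]
  show "0 \<le> hdist x y" for x y
    using diff hnorm_nonneg by (simp add: hdist_def)
  show "hdist x y = hdist y x" for x y
    by (simp add: hdist_def hnorm_minus_commute)
  show "hdist x y = 0 \<longleftrightarrow> x = y" if "x \<in> V" "y \<in> V" for x y
    using that diff by (simp add: hdist_def hnorm_eq_0_iff)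
  show "hdist x z \<le> hdist x y + hdist y z" if "x \<in> V" "y \<in> V" "z \<in> V" for x y z
    using that diff hnorm_triangle[of "x - y" "y - z"] by (simp add: hdist_def)
qed

end

locale complex_hilbert_space = complex_inner_product_space scale V ip
  for scale :: "complex \<Rightarrow> 'v::ab_group_add \<Rightarrow> 'v" and V ip +
  assumes complete: "metric.mcomplete"
begin

text \<open>The vector \<open>hadjoint T y\<close> exists for every bounded operator \<open>T\<close> on \<open>V\<close> by the Riesz
  representation theorem; it is unique for any \<open>T\<close>.\<close>

definition hadjoint :: "('v \<Rightarrow> 'v) \<Rightarrow> 'v \<Rightarrow> 'v" where
  "hadjoint T y = (THE z. z \<in> V \<and> (\<forall>x\<in>V. ip (T x) y = ip x z))"

text \<open>To be applied to linear operators \<open>T\<close> from \<open>V\<close> to \<open>V\<close>.\<close>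

definition compact_operator :: "('v \<Rightarrow> 'v) \<Rightarrow> bool" where
  "compact_operator T \<longleftrightarrow>
     compactin metric.mtopology (metric.mtopology closure_of (T ` metric.mcball 0 1))"

definition essentially_normal :: "('v \<Rightarrow> 'v) \<Rightarrow> bool" where
  "essentially_normal T \<longleftrightarrow> compact_operator (\<lambda>x. hadjoint T (T x) - T (hadjoint T x))"

end

definition fun_scale :: "complex \<Rightarrow> ('x \<Rightarrow> complex) \<Rightarrow> 'x \<Rightarrow> complex" where
  "fun_scale c f = (\<lambda>x. c * f x)"

lemma vector_space_fun_scale: "vector_space fun_scale"
  by unfold_locales (auto simp: fun_scale_def algebra_simps)

text \<open>A Hilbert space of functions on the type \<open>'x\<close> with reproducing kernel \<open>s\<close>. The reproducing
  property and the Cauchy-Schwarz inequality entail that point evaluations are bounded.\<close>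

locale rkhs = complex_hilbert_space fun_scale H ip
  for H :: "('x \<Rightarrow> complex) set"
    and ip :: "('x \<Rightarrow> complex) \<Rightarrow> ('x \<Rightarrow> complex) \<Rightarrow> complex" +
  fixes s :: "'x \<Rightarrow> 'x \<Rightarrow> complex"
  assumes kernel_mem: "(\<lambda>z. s z w) \<in> H"
    and reproducing: "f \<in> H \<Longrightarrow> f w = ip f (\<lambda>z. s z w)"

definition mult_op :: "('x \<Rightarrow> complex) \<Rightarrow> ('x \<Rightarrow> complex) \<Rightarrow> 'x \<Rightarrow> complex" where
  "mult_op \<phi> f = (\<lambda>x. \<phi> x * f x)"

definition Mult :: "('x \<Rightarrow> complex) set \<Rightarrow> ('x \<Rightarrow> complex) set" where
  "Mult H = {\<phi>. \<forall>f\<in>H. mult_op \<phi> f \<in> H}"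

text \<open>HOL cannot quantify over the type carrying the auxiliary Hilbert space \<open>K\<close>, so \<open>K\<close> is a
  parameter. Used as a hypothesis with \<open>K\<close> arbitrary, this amounts to existence of some \<open>K\<close>.\<close>

definition normalized_complete_pick_kernel ::
  "(complex \<Rightarrow> 'k::ab_group_add \<Rightarrow> 'k) \<Rightarrow> 'k set \<Rightarrow> ('k \<Rightarrow> 'k \<Rightarrow> complex)
     \<Rightarrow> ('x \<Rightarrow> 'x \<Rightarrow> complex) \<Rightarrow> bool" where
  "normalized_complete_pick_kernel scaleK K ipK s \<longleftrightarrow>
     complex_hilbert_space scaleK K ipK \<and>
     (\<exists>b. (\<forall>z. b z \<in> K \<and> complex_inner_product_space.hnorm ipK (b z) < 1) \<and>
          (\<exists>w0. b w0 = 0) \<and>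
          (\<forall>z w. s z w = 1 / (1 - ipK (b z) (b w))))"

end

theory Submission
  imports Defs
begin

text \<open>
  Write \<open>k\<^sub>z\<close> for the normalized kernel at \<open>z\<close>. It is an eigenvector of the adjoint of a multiplication
  operator \<open>M\<close> with symbol \<open>\<phi>\<close>, so \<open>\<parallel>(M - \<phi>(z)) k\<^sub>z\<parallel>\<^sup>2\<close> is the quadratic form of the self-commutator
  of \<open>M\<close> at \<open>k\<^sub>z\<close>. If \<open>M\<close> is essentially normal, this tends to \<open>0\<close> whenever \<open>s(z, z) \<rightarrow> \<infinity>\<close>; evaluating at
  \<open>w\<close> gives \<open>\<phi>(w) - \<phi>(z) \<rightarrow> 0\<close> along pairs for which \<open>|\<langle>k\<^sub>z, k\<^sub>w\<rangle>|\<close> stays away from \<open>0\<close>. By connectedness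
  there are pairs \<open>(z\<^sub>n, w\<^sub>n)\<close> with \<open>|\<langle>k\<^sub>z, k\<^sub>w\<rangle>| = 1/2\<close> and \<open>s(z\<^sub>n, z\<^sub>n) \<rightarrow> \<infinity>\<close> as fast as desired. A multiplier
  that separates them is obtained from the complete Pick property: every kernel function
  \<open>s(\<cdot>, u)\<close> is accretive, that is, \<open>(s(z, u) + cnj (s(w, u))) s(z, w)\<close> is positive semidefinite.
  Hence so is \<open>G = \<Sum> c\<^sub>n s(\<cdot>, z\<^sub>n) / s(z\<^sub>n, z\<^sub>n)\<close> with \<open>c\<^sub>n\<close> growing geometrically, and the product
  \<open>\<phi>\<close> of the Cayley transforms \<open>(c\<^sub>n - G) / (c\<^sub>n + G)\<close> is a contractive multiplier.
\<close>

section \<open>Positive semidefinite kernels\<close>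

text \<open>Hermitian symmetry is demanded separately because the real part of the form does not
  detect it: for a real antisymmetric kernel that real part is always \<open>0\<close>.\<close>

definition psd :: "('x \<Rightarrow> 'x \<Rightarrow> complex) \<Rightarrow> bool" where
  "psd k \<longleftrightarrow> (\<forall>z w. k w z = cnj (k z w)) \<and>
     (\<forall>F c. finite F \<longrightarrow> 0 \<le> Re (\<Sum>z\<in>F. \<Sum>w\<in>F. c z * cnj (c w) * k z w))"

lemma psdI:
  assumes "\<And>z w. k w z = cnj (k z w)"
    and "\<And>F c. finite F \<Longrightarrow> 0 \<le> Re (\<Sum>z\<in>F. \<Sum>w\<in>F. c z * cnj (c w) * k z w)"
  shows "psd k"
  using assms unfolding psd_def by blast

lemma psd_herm: "psd k \<Longrightarrow> k w z = cnj (k z w)"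
  unfolding psd_def by blast

lemma psd_form: "psd k \<Longrightarrow> finite F \<Longrightarrow> 0 \<le> Re (\<Sum>z\<in>F. \<Sum>w\<in>F. c z * cnj (c w) * k z w)"
  unfolding psd_def by blast

lemma psd_diag: "psd k \<Longrightarrow> 0 \<le> Re (k z z)"
  using psd_form[of k "{z}" "\<lambda>_. 1"] by simp

lemma psd_add: "psd k \<Longrightarrow> psd l \<Longrightarrow> psd (\<lambda>z w. k z w + l z w)"
proof (rule psdI)
  assume k: "psd k" and l: "psd l"
  show "k w z + l w z = cnj (k z w + l z w)" for z w
    using psd_herm[OF k, of w z] psd_herm[OF l, of w z] by simp
  show "0 \<le> Re (\<Sum>z\<in>F. \<Sum>w\<in>F. c z * cnj (c w) * (k z w + l z w))" if "finite F" for F c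
    using psd_form[OF k that, of c] psd_form[OF l that, of c]
    by (simp only: distrib_left sum.distrib plus_complex.sel)
qed

lemma psd_congruence:
  assumes "psd k"
  shows "psd (\<lambda>z w. f z * cnj (f w) * k z w)"
proof (rule psdI)
  show "f w * cnj (f z) * k w z = cnj (f z * cnj (f w) * k z w)" for z w
    using psd_herm[OF assms, of w z] by simp
  show "0 \<le> Re (\<Sum>z\<in>F. \<Sum>w\<in>F. c z * cnj (c w) * (f z * cnj (f w) * k z w))" if "finite F" for F c
    using psd_form[OF assms that, of "\<lambda>z. c z * f z"] by (simp add: mult_ac)
qed

lemma psd_transpose:
  assumes "psd k"
  shows "psd (\<lambda>z w. k w z)"
proof (rule psdI)
  show "k z w = cnj (k w z)" for z w
    by (rule psd_herm[OF assms])
  show "0 \<le> Re (\<Sum>z\<in>F. \<Sum>w\<in>F. c z * cnj (c w) * k w z)" if "finite F" for F c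
    using psd_form[OF assms that, of "\<lambda>z. cnj (c z)"] by (subst sum.swap) (simp add: mult_ac)
qed

lemma psd_zero: "psd (\<lambda>z w. 0)"
  by (rule psdI) auto

lemma psd_scale:
  assumes "psd k" "0 \<le> r"
  shows "psd (\<lambda>z w. of_real r * k z w)"
  using psd_congruence[OF assms(1), of "\<lambda>_. of_real (sqrt r)"] assms(2)
  by (simp flip: of_real_mult)

lemma psd_one: "psd (\<lambda>z w. 1)"
proof (rule psdI)
  fix F :: "'a set" and c :: "'a \<Rightarrow> complex"
  have "(\<Sum>z\<in>F. \<Sum>w\<in>F. c z * cnj (c w) * 1) = (\<Sum>z\<in>F. c z) * cnj (\<Sum>z\<in>F. c z)"
    by (simp add: sum_product)
  then show "0 \<le> Re (\<Sum>z\<in>F. \<Sum>w\<in>F. c z * cnj (c w) * 1)"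
    by (simp only: complex_mult_cnj Re_complex_of_real) simp
qed simp

lemma psd_limit:
  assumes k: "\<And>n. psd (k n)" and lim: "\<And>z w. (\<lambda>n. k n z w) \<longlonglongrightarrow> l z w"
  shows "psd l"
proof (rule psdI)
  show "l w z = cnj (l z w)" for z w
    using lim[of w z] tendsto_cnj[OF lim[of z w]] psd_herm[OF k, of _ w z]
    by (auto intro: LIMSEQ_unique)
  show "0 \<le> Re (\<Sum>z\<in>F. \<Sum>w\<in>F. c z * cnj (c w) * l z w)" if "finite F" for F c
  proof (rule LIMSEQ_le_const)
    show "(\<lambda>n. Re (\<Sum>z\<in>F. \<Sum>w\<in>F. c z * cnj (c w) * k n z w))
        \<longlonglongrightarrow> Re (\<Sum>z\<in>F. \<Sum>w\<in>F. c z * cnj (c w) * l z w)"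
      by (intro tendsto_intros lim)
  qed (use psd_form[OF k that] in blast)
qed

text \<open>On \<open>{x, w}\<close>, with coefficient \<open>t\<close> at \<open>x\<close> and
  \<open>1\<close> at \<open>w\<close>, the quadratic term in \<open>t\<close> vanishes, so the form
  is unbounded below in \<open>t\<close> unless \<open>k x w = 0\<close>.\<close>

lemma psd_diag_eq_0:
  assumes k: "psd k" and 0: "k x x = 0"
  shows "k x w = 0"
proof (rule ccontr)
  assume ne: "k x w \<noteq> 0"
  then have xw: "x \<noteq> w"
    using 0 by auto
  \<comment> \<open>Chosen so that \<open>t * k x w = - (Re (k w w) + 1)\<close>, which makes the
    form \<open>- Re (k w w) - 2\<close>.\<close>
  define t where "t = - of_real ((Re (k w w) + 1) / (cmod (k x w))\<^sup>2) * cnj (k x w)"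
  have "0 \<le> Re (\<Sum>z\<in>{x,w}. \<Sum>v\<in>{x,w}. (if z = x then t else 1) * cnj (if v = x then t else 1) * k z v)"
    by (rule psd_form[OF k]) simp
  also have "\<dots> = Re (t * k x w + cnj (t * k x w) + k w w)"
    using xw 0 psd_herm[OF k, of w x] by simp
  also have "t * k x w = - of_real ((Re (k w w) + 1) / (cmod (k x w))\<^sup>2) * of_real ((cmod (k x w))\<^sup>2)"
    unfolding t_def complex_norm_square by (simp only: mult_ac)
  also have "\<dots> = - of_real (Re (k w w) + 1)"
    using ne by (simp flip: of_real_mult)
  finally show False
    using psd_diag[OF k, of w] by simp
qed

text \<open>Minimising the form of \<open>k\<close> over an extra coefficient at \<open>x\<close>
  gives the form of the Schur complement. If \<open>k x x = 0\<close>, division by zero makes the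
  complement \<open>k\<close> itself.\<close>

lemma psd_Schur_complement:
  assumes k: "psd k"
  shows "psd (\<lambda>z w. k z w - k z x * k x w / k x x)"
proof (cases "k x x = 0")
  case True
  then show ?thesis using k by simp
next
  case False
  have real: "k x x = of_real (Re (k x x))"
    using psd_herm[OF k, of x x] by (simp add: complex_eq_iff)
  define r where "r = Re (k x x)"
  have r: "k x x = of_real r" "r \<noteq> 0"
    using real False by (auto simp: r_def)
  show ?thesis
  proof (rule psdI)
    show "k w z - k w x * k x z / k x x = cnj (k z w - k z x * k x w / k x x)" for z w
      using psd_herm[OF k, of w z] psd_herm[OF k, of w x] psd_herm[OF k, of x z] r
      by simp
    fix F :: "'a set" and c :: "'a \<Rightarrow> complex"
    assume F: "finite F"
    define F' where "F' = insert x F"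
    \<comment> \<open>Extending \<open>c\<close> by zero allows the extra coefficient at
      \<open>x\<close> whether or not \<open>x\<close> lies in \<open>F\<close>.\<close>
    define c0 where "c0 z = (if z \<in> F then c z else 0)" for z
    define a where "a = (\<Sum>z\<in>F'. c0 z * k z x)"
    have F': "finite F'" "F \<subseteq> F'" "x \<in> F'"
      using F by (auto simp: F'_def)
    \<comment> \<open>The minimiser: completing the square in \<open>t\<close> leaves
      \<open>- a * cnj a / r\<close>.\<close>
    define t where "t = - a / of_real r"
    have ca: "cnj a = (\<Sum>w\<in>F'. cnj (c0 w) * k x w)"
      unfolding a_def cnj_sum by (rule sum.cong) (simp_all add: psd_herm[OF k, of x])
    have del: "(\<Sum>z\<in>F'. (if z = x then f z else 0)) = f x" for f :: "'a \<Rightarrow> complex"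
      using F' by (simp add: sum.delta)
    have "(\<Sum>z\<in>F'. \<Sum>w\<in>F'. (c0 z + (if z = x then t else 0)) * cnj (c0 w + (if w = x then t else 0)) * k z w)
       = (\<Sum>z\<in>F'. \<Sum>w\<in>F'. c0 z * cnj (c0 w) * k z w)
         + (\<Sum>z\<in>F'. \<Sum>w\<in>F'. (if w = x then c0 z * cnj t * k z w else 0))
         + (\<Sum>z\<in>F'. if z = x then (\<Sum>w\<in>F'. t * cnj (c0 w) * k z w) else 0)
         + (\<Sum>z\<in>F'. if z = x then (\<Sum>w\<in>F'. if w = x then t * cnj t * k z w else 0) else 0)"
      unfolding sum.distrib[symmetric]
      by (intro sum.cong refl) (auto simp: algebra_simps sum.distrib[symmetric] intro!: sum.cong)
    also have "\<dots> = (\<Sum>z\<in>F'. \<Sum>w\<in>F'. c0 z * cnj (c0 w) * k z w) + cnj t * a + t * cnj a + t * cnj t * r"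
      unfolding del ca unfolding a_def by (simp add: sum_distrib_left mult_ac r)
    also have "\<dots> = (\<Sum>z\<in>F'. \<Sum>w\<in>F'. c0 z * cnj (c0 w) * k z w) - a * cnj a / of_real r"
      using r(2) by (simp add: t_def field_simps)
    also have "a * cnj a / of_real r = (\<Sum>z\<in>F'. \<Sum>w\<in>F'. c0 z * cnj (c0 w) * (k z x * k x w / k x x))"
      unfolding ca unfolding a_def sum_product by (simp add: sum_divide_distrib mult_ac r)
    also have "(\<Sum>z\<in>F'. \<Sum>w\<in>F'. c0 z * cnj (c0 w) * k z w) - \<dots>
        = (\<Sum>z\<in>F'. \<Sum>w\<in>F'. c0 z * cnj (c0 w) * (k z w - k z x * k x w / k x x))"
      by (simp add: sum_subtractf[symmetric] algebra_simps)
    also have "\<dots> = (\<Sum>z\<in>F. \<Sum>w\<in>F. c0 z * cnj (c0 w) * (k z w - k z x * k x w / k x x))"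
    proof -
      have "(\<Sum>z\<in>F'. f z) = (\<Sum>z\<in>F. f z)" if "\<And>z. z \<notin> F \<Longrightarrow> f z = 0" for f :: "'a \<Rightarrow> complex"
        using F' that by (intro sum.mono_neutral_right) auto
      then show ?thesis
        by (simp add: c0_def)
    qed
    also have "\<dots> = (\<Sum>z\<in>F. \<Sum>w\<in>F. c z * cnj (c w) * (k z w - k z x * k x w / k x x))"
      by (intro sum.cong) (auto simp: c0_def)
    finally show "0 \<le> Re (\<Sum>z\<in>F. \<Sum>w\<in>F. c z * cnj (c w) * (k z w - k z x * k x w / k x x))"
      using psd_form[OF k F'(1), of "\<lambda>z. c0 z + (if z = x then t else 0)"] by simp
  qed
qed

text \<open>Cholesky elimination: each point splits off a rank-one kernel, whose product with \<open>l\<close> is a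
  congruence of \<open>l\<close>.\<close>

lemma psd_mult:
  assumes k: "psd k" and l: "psd l"
  shows "psd (\<lambda>z w. k z w * l z w)"
proof (rule psdI)
  show "k w z * l w z = cnj (k z w * l z w)" for z w
    using psd_herm[OF k, of w z] psd_herm[OF l, of w z] by simp
  show "0 \<le> Re (\<Sum>z\<in>F. \<Sum>w\<in>F. c z * cnj (c w) * (k z w * l z w))" if "finite F" for F c
    using that k
  proof (induction F arbitrary: k)
    case empty
    then show ?case by simp
  next
    case (insert x F)
    define k' where "k' = (\<lambda>z w. k z w - k z x * k x w / k x x)"
    have psd: "psd k'"
      unfolding k'_def by (rule psd_Schur_complement[OF insert.prems])
    \<comment> \<open>Row and column of \<open>k'\<close> at \<open>x\<close> vanish, also when
      \<open>k x x = 0\<close>. So \<open>x\<close> drops out of the sum, and the induction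
      hypothesis, stated for all kernels, applies to \<open>k'\<close> on \<open>F\<close>.\<close>
    have zero: "k' x w = 0" "k' w x = 0" for w
    proof -
      show "k' x w = 0"
        using psd_diag_eq_0[OF insert.prems, of x w] by (auto simp: k'_def)
      then show "k' w x = 0"
        using psd_herm[OF psd, of w x] by simp
    qed
    define r where "r = Re (k x x)"
    have kr: "k x x = of_real r" "0 \<le> r"
      using psd_herm[OF insert.prems, of x x] psd_diag[OF insert.prems, of x]
      by (auto simp: complex_eq_iff r_def)
    have one: "psd (\<lambda>z w. of_real (1 / r) * (k z x * cnj (k w x) * l z w))"
      by (intro psd_scale psd_congruence l) (use kr in simp)
    have split: "k z w * l z w = of_real (1 / r) * (k z x * cnj (k w x) * l z w) + k' z w * l z w" for z w
      using psd_herm[OF insert.prems, of x w] by (simp add: k'_def kr algebra_simps)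
    have "(\<Sum>z\<in>insert x F. \<Sum>w\<in>insert x F. c z * cnj (c w) * (k' z w * l z w))
        = (\<Sum>z\<in>F. \<Sum>w\<in>F. c z * cnj (c w) * (k' z w * l z w))"
      using insert.hyps by (simp add: zero)
    then have "0 \<le> Re (\<Sum>z\<in>insert x F. \<Sum>w\<in>insert x F. c z * cnj (c w) * (k' z w * l z w))"
      using insert.IH[OF psd] by simp
    with psd_form[OF one, of "insert x F" c] insert.hyps(1) show ?case
      unfolding split distrib_left sum.distrib plus_complex.sel by simp
  qed
qed

section \<open>Hilbert spaces\<close>

context complex_inner_product_space
begin

lemma mem_0: "0 \<in> V"
  and mem_add: "x \<in> V \<Longrightarrow> y \<in> V \<Longrightarrow> x + y \<in> V"
  and mem_diff: "x \<in> V \<Longrightarrow> y \<in> V \<Longrightarrow> x - y \<in> V"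
  and mem_scale: "x \<in> V \<Longrightarrow> scale c x \<in> V"
  and mem_sum: "(\<And>i. i \<in> F \<Longrightarrow> u i \<in> V) \<Longrightarrow> sum u F \<in> V"
  using subspace_carrier
  by (auto intro: subspace_0 subspace_add subspace_diff subspace_scale subspace_sum)

lemma ip_diff_left: "\<lbrakk>x \<in> V; y \<in> V; z \<in> V\<rbrakk> \<Longrightarrow> ip (x - y) z = ip x z - ip y z"
  using ip_add_left[of "x - y" y z] by (simp add: mem_diff)

lemma ip_diff_right: "\<lbrakk>x \<in> V; y \<in> V; z \<in> V\<rbrakk> \<Longrightarrow> ip x (y - z) = ip x y - ip x z"
  using ip_add_right[of x "y - z" z] by (simp add: mem_diff)

lemma ip_sum_left:
  "(\<And>i. i \<in> F \<Longrightarrow> u i \<in> V) \<Longrightarrow> y \<in> V \<Longrightarrow> ip (\<Sum>i\<in>F. scale (c i) (u i)) y = (\<Sum>i\<in>F. c i * ip (u i) y)"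
  by (induction F rule: infinite_finite_induct)
    (simp_all add: ip_zero_left ip_add_left ip_scale_left mem_sum mem_scale)

lemma ip_sum_right:
  "(\<And>i. i \<in> F \<Longrightarrow> u i \<in> V) \<Longrightarrow> y \<in> V \<Longrightarrow> ip y (\<Sum>i\<in>F. scale (c i) (u i)) = (\<Sum>i\<in>F. cnj (c i) * ip y (u i))"
  by (induction F rule: infinite_finite_induct)
    (simp_all add: ip_zero_right ip_add_right ip_scale_right mem_sum mem_scale)

lemma ip_sum_sum:
  "(\<And>i. i \<in> F \<Longrightarrow> u i \<in> V) \<Longrightarrow>
    ip (\<Sum>i\<in>F. scale (c i) (u i)) (\<Sum>i\<in>F. scale (c i) (u i)) = (\<Sum>i\<in>F. \<Sum>j\<in>F. c i * cnj (c j) * ip (u i) (u j))"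
  by (subst sum.swap) (simp add: ip_sum_left ip_sum_right mem_sum mem_scale sum_distrib_left mult_ac)

lemma ip_self:
  assumes "x \<in> V"
  shows "ip x x = of_real ((hnorm x)\<^sup>2)"
proof (rule complex_eqI)
  show "Re (ip x x) = Re (of_real ((hnorm x)\<^sup>2))"
    by (simp only: hnorm_power2[OF assms] Re_complex_of_real)
  have "Im (ip x x) = - Im (ip x x)"
    by (subst ip_commute[OF assms assms]) simp
  then show "Im (ip x x) = Im (of_real ((hnorm x)\<^sup>2))"
    by simp
qed

lemma hnorm_scale:
  assumes x: "x \<in> V"
  shows "hnorm (scale c x) = cmod c * hnorm x"
proof (rule power2_eq_imp_eq)
  have "ip (scale c x) (scale c x) = c * cnj c * ip x x"
    by (simp only: ip_scale_left[OF x mem_scale[OF x]] ip_scale_right[OF x x] mult.assoc)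
  also have "\<dots> = of_real ((cmod c * hnorm x)\<^sup>2)"
    by (simp only: ip_self[OF x] complex_norm_square[symmetric] power_mult_distrib of_real_mult)
  finally show "(hnorm (scale c x))\<^sup>2 = (cmod c * hnorm x)\<^sup>2"
    by (simp only: hnorm_power2[OF mem_scale[OF x]] Re_complex_of_real)
qed (simp_all add: hnorm_nonneg x mem_scale)

lemma hnorm_power2_diff:
  "x \<in> V \<Longrightarrow> y \<in> V \<Longrightarrow> (hnorm (x - y))\<^sup>2 = (hnorm x)\<^sup>2 - 2 * Re (ip x y) + (hnorm y)\<^sup>2"
  using hnorm_power2_add[of "x - y" y] by (simp add: mem_diff ip_diff_left hnorm_power2)

lemma Cauchy_Schwarz:
  assumes "x \<in> V" "y \<in> V"
  shows "cmod (ip x y) \<le> hnorm x * hnorm y"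
proof (cases "ip x y = 0")
  case True
  then show ?thesis using assms by (simp add: hnorm_nonneg)
next
  case False
  let ?n = "of_real (cmod (ip x y)) :: complex"
  define c where "c = cnj (ip x y) / ?n"
  have "cmod c = 1"
    using False by (simp add: c_def norm_divide)
  moreover have "c * ip x y = ?n"
  proof -
    have "c * ip x y = ip x y * cnj (ip x y) / ?n"
      by (simp add: c_def)
    also have "\<dots> = ?n"
      using False by (simp only: complex_norm_square[symmetric]) (simp add: power2_eq_square)
    finally show ?thesis .
  qed
  ultimately show ?thesis
    using Re_ip_le[of "scale c x" y] assms by (simp add: mem_scale ip_scale_left hnorm_scale)
qed

lemma psd_Gram: "(\<And>z. u z \<in> V) \<Longrightarrow> psd (\<lambda>z w. ip (u z) (u w))"
proof (rule psdI)
  assume u: "\<And>z. u z \<in> V"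
  show "ip (u w) (u z) = cnj (ip (u z) (u w))" for z w
    by (rule ip_commute[OF u u])
  show "0 \<le> Re (\<Sum>z\<in>F. \<Sum>w\<in>F. c z * cnj (c w) * ip (u z) (u w))" for F c
    using ip_self_nonneg[of "\<Sum>z\<in>F. scale (c z) (u z)"] u by (simp add: ip_sum_sum mem_sum mem_scale)
qed

text \<open>The form is the squared norm of a combination of the vectors minus the squared modulus
  of its inner product with \<open>e\<close>, so Cauchy-Schwarz applies. Accretivity of the kernel
  functions rests on this, with \<open>e\<close> a value of the map \<open>b\<close>.\<close>

lemma psd_Gram_deflate:
  fixes u :: "'i \<Rightarrow> 'v"
  assumes u: "\<And>z. u z \<in> V" and e: "e \<in> V" "hnorm e \<le> 1"
  shows "psd (\<lambda>z w. ip (u z) (u w) - ip (u z) e * cnj (ip (u w) e))"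
proof (rule psdI)
  show "ip (u w) (u z) - ip (u w) e * cnj (ip (u z) e) = cnj (ip (u z) (u w) - ip (u z) e * cnj (ip (u w) e))" for z w
    using ip_commute[OF u u, of w z] by simp
  fix F :: "'i set" and c :: "'i \<Rightarrow> complex"
  let ?x = "\<Sum>z\<in>F. scale (c z) (u z)"
  have x: "?x \<in> V"
    using u by (simp add: mem_sum mem_scale)
  have "(\<Sum>z\<in>F. \<Sum>w\<in>F. c z * cnj (c w) * (ip (u z) (u w) - ip (u z) e * cnj (ip (u w) e)))
      = ip ?x ?x - ip ?x e * cnj (ip ?x e)"
  proof -
    have "ip ?x e * cnj (ip ?x e) = (\<Sum>z\<in>F. \<Sum>w\<in>F. c z * cnj (c w) * (ip (u z) e * cnj (ip (u w) e)))"
      unfolding ip_sum_left[OF u e(1)] cnj_sum sum_product by (simp add: mult_ac)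
    then show ?thesis
      by (simp only: ip_sum_sum[OF u] right_diff_distrib sum_subtractf)
  qed
  also have "\<dots> = of_real ((hnorm ?x)\<^sup>2 - (cmod (ip ?x e))\<^sup>2)"
    by (simp only: ip_self[OF x] complex_norm_square of_real_diff)
  finally have "Re (\<Sum>z\<in>F. \<Sum>w\<in>F. c z * cnj (c w) * (ip (u z) (u w) - ip (u z) e * cnj (ip (u w) e)))
      = (hnorm ?x)\<^sup>2 - (cmod (ip ?x e))\<^sup>2"
    by (simp only: Re_complex_of_real)
  moreover have "cmod (ip ?x e) \<le> hnorm ?x"
    using Cauchy_Schwarz[OF x e(1)] mult_left_mono[OF e(2) hnorm_nonneg[OF x]] by simp
  ultimately show "0 \<le> Re (\<Sum>z\<in>F. \<Sum>w\<in>F. c z * cnj (c w) * (ip (u z) (u w) - ip (u z) e * cnj (ip (u w) e)))"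
    using power_mono[of "cmod (ip ?x e)" "hnorm ?x" 2] by simp
qed

lemma limitin_iff_hnorm:
  assumes "\<And>n. u n \<in> V"
  shows "limitin metric.mtopology u v sequentially \<longleftrightarrow> v \<in> V \<and> (\<lambda>n. hnorm (u n - v)) \<longlonglongrightarrow> 0"
proof -
  have "hnorm (u n - v) \<ge> 0" if "v \<in> V" for n
    using assms that by (simp add: hnorm_nonneg mem_diff)
  then show ?thesis
    using assms by (auto simp: metric.limit_metric_sequentially hdist_def LIMSEQ_def)
qed

lemma tendsto_ip_right:
  assumes u: "\<And>n. u n \<in> V" and v: "v \<in> V" and x: "x \<in> V" and lim: "(\<lambda>n. hnorm (u n - v)) \<longlonglongrightarrow> 0"
  shows "(\<lambda>n. ip x (u n)) \<longlonglongrightarrow> ip x v"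
proof -
  have "(\<lambda>n. hnorm x * hnorm (u n - v)) \<longlonglongrightarrow> 0"
    using tendsto_mult_left[OF lim, of "hnorm x"] by simp
  moreover have "\<forall>n. norm (ip x (u n) - ip x v) \<le> hnorm x * hnorm (u n - v)"
    using Cauchy_Schwarz[OF x mem_diff[OF u v]] by (simp add: ip_diff_right[OF x u v])
  ultimately have "(\<lambda>n. ip x (u n) - ip x v) \<longlonglongrightarrow> 0"
    by (rule Lim_null_comparison[OF always_eventually, rotated])
  then show ?thesis
    by (simp add: LIM_zero_iff)
qed

end

context complex_hilbert_space
begin

text \<open>A bounded functional given as a linear relation \<open>R\<close>, so that it need not be shown to be well
  defined on the span of vectors that may be linearly dependent. The representing vector is the
  limit of a minimising sequence of \<open>\<parallel>u\<parallel>\<^sup>2 - 2 Re l\<close>.\<close>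

lemma Riesz_relation:
  assumes ne: "(0, 0) \<in> R"
    and add: "\<And>u l u' l'. (u, l) \<in> R \<Longrightarrow> (u', l') \<in> R \<Longrightarrow> (u + u', l + l') \<in> R"
    and sc: "\<And>u l c. (u, l) \<in> R \<Longrightarrow> (scale c u, c * l) \<in> R"
    and V: "\<And>u l. (u, l) \<in> R \<Longrightarrow> u \<in> V"
    and bd: "\<And>u l. (u, l) \<in> R \<Longrightarrow> cmod l \<le> C * hnorm u"
  obtains v u where "v \<in> V" "\<And>x l. (x, l) \<in> R \<Longrightarrow> ip x v = l" "hnorm v \<le> C \<or> v = 0"
    "\<And>n. u n \<in> fst ` R" "(\<lambda>n. hnorm (u n - v)) \<longlonglongrightarrow> 0"
proof -
  define Q where "Q = (\<lambda>(u, l). (hnorm u)\<^sup>2 - 2 * Re l)"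
  have Q_bd: "- C\<^sup>2 \<le> Q p" if "p \<in> R" for p
  proof -
    obtain u l where p: "p = (u, l)" by (cases p)
    have "Re l \<le> C * hnorm u"
      using bd[of u l] that p complex_Re_le_cmod[of l] by simp
    moreover have "0 \<le> (hnorm u - C)\<^sup>2" by simp
    ultimately show ?thesis
      by (simp add: p Q_def power2_diff mult.commute)
  qed
  define m where "m = Inf (Q ` R)"
  have bdd: "bdd_below (Q ` R)"
    using Q_bd by (intro bdd_belowI2) blast
  have m_le: "m \<le> Q p" if "p \<in> R" for p
    unfolding m_def by (rule cInf_lower[OF _ bdd]) (use that in simp)
  have "\<exists>p\<in>R. Q p < m + 1 / Suc n" for n
  proof -
    have "Inf (Q ` R) < m + 1 / Suc n" by (simp add: m_def)
    then show ?thesis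
      using cInf_less_iff[OF _ bdd, of "m + 1 / Suc n"] ne by auto
  qed
  then obtain p where p: "\<And>n. p n \<in> R" "\<And>n. Q (p n) < m + 1 / Suc n"
    by metis
  define u l where "u n = fst (p n)" and "l n = snd (p n)" for n
  have ul: "(u n, l n) \<in> R" "(hnorm (u n))\<^sup>2 - 2 * Re (l n) < m + 1 / Suc n" for n
    using p[of n] by (auto simp: u_def l_def Q_def split_beta)
  have uV: "u n \<in> V" for n
    using V ul by blast
  \<comment> \<open>Parallelogram law: at the midpoint of two near-minimisers \<open>Q\<close> is
    still at least \<open>m\<close>, which forces them to be close.\<close>
  have par: "(hnorm (u n - u k))\<^sup>2 \<le> 2 / Suc n + 2 / Suc k" for n k
  proof -
    have "(scale (1/2) (u n + u k), 1/2 * (l n + l k)) \<in> R"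
      by (intro sc add ul)
    from m_le[OF this] have "m \<le> (hnorm (scale (1/2) (u n + u k)))\<^sup>2 - Re (l n + l k)"
      unfolding Q_def by (simp add: add_divide_distrib)
    also have "hnorm (scale (1/2) (u n + u k)) = 1/2 * hnorm (u n + u k)"
      using uV by (simp add: hnorm_scale mem_add)
    finally have "4 * m \<le> (hnorm (u n + u k))\<^sup>2 - 4 * Re (l n) - 4 * Re (l k)"
      by (simp add: power_divide)
    moreover have "(hnorm (u n - u k))\<^sup>2 = 2 * (hnorm (u n))\<^sup>2 + 2 * (hnorm (u k))\<^sup>2 - (hnorm (u n + u k))\<^sup>2"
      using uV by (simp add: hnorm_power2_diff hnorm_power2_add)
    ultimately have "(hnorm (u n - u k))\<^sup>2 \<le> 2 * (1 / Suc n) + 2 * (1 / Suc k)"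
      using ul(2)[of n] ul(2)[of k] by linarith
    then show ?thesis by simp
  qed
  have "metric.MCauchy u"
    unfolding metric.MCauchy_def
  proof (intro conjI allI impI)
    fix e :: real assume "e > 0"
    then obtain N where N: "1 / Suc N < e\<^sup>2 / 4"
      using reals_Archimedean[of "e\<^sup>2 / 4"] by (auto simp: inverse_eq_divide)
    have "hdist (u n) (u k) < e" if "N \<le> n" "N \<le> k" for n k
    proof -
      have "1 / Suc n \<le> 1 / Suc N" "1 / Suc k \<le> 1 / Suc N"
        using that by (auto intro!: divide_left_mono)
      then have "(hnorm (u n - u k))\<^sup>2 < e\<^sup>2"
        using par[of n k] N by linarith
      then have "hnorm (u n - u k) < e"
        using \<open>e > 0\<close> by (intro power2_less_imp_less[of _ e]) auto
      then show ?thesis using uV by (simp add: hdist_def)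
    qed
    then show "\<exists>N. \<forall>n n'. N \<le> n \<longrightarrow> N \<le> n' \<longrightarrow> hdist (u n) (u n') < e" by blast
  qed (use uV in auto)
  then obtain v where "limitin metric.mtopology u v sequentially"
    using complete unfolding metric.mcomplete_def by blast
  then have v: "v \<in> V" and lim: "(\<lambda>n. hnorm (u n - v)) \<longlonglongrightarrow> 0"
    using limitin_iff_hnorm[of u v] uV by auto
  have rep: "ip x v = y" if xy: "(x, y) \<in> R" for x y
  proof -
    have x: "x \<in> V" using V xy .
    define d where "d = ip x v - y"
    \<comment> \<open>First variation: moving \<open>u n\<close> by \<open>scale t x\<close> cannot
      lower \<open>Q\<close> by more than \<open>1 / Suc n\<close>; the inequality is then passed to
      the limit.\<close>
    have key: "0 \<le> 2 * Re (t * d) + (cmod t * hnorm x)\<^sup>2" for t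
    proof (rule LIMSEQ_le_const)
      have "(\<lambda>n. 2 * Re (t * (ip x (u n) - y)) + (cmod t * hnorm x)\<^sup>2 + 1 / Suc n)
          \<longlonglongrightarrow> 2 * Re (t * d) + (cmod t * hnorm x)\<^sup>2 + 0"
        unfolding d_def by (intro tendsto_intros tendsto_ip_right[OF uV v x lim] LIMSEQ_Suc lim_1_over_n)
      then show "(\<lambda>n. 2 * Re (t * (ip x (u n) - y)) + (cmod t * hnorm x)\<^sup>2 + 1 / Suc n)
          \<longlonglongrightarrow> 2 * Re (t * d) + (cmod t * hnorm x)\<^sup>2" by simp
      have "0 \<le> 2 * Re (t * (ip x (u n) - y)) + (cmod t * hnorm x)\<^sup>2 + 1 / Suc n" for n
      proof -
        have "m \<le> Q (scale t x + u n, t * y + l n)"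
          by (intro m_le add sc xy ul)
        also have "\<dots> = (cmod t * hnorm x)\<^sup>2 + 2 * Re (t * ip x (u n)) + (hnorm (u n))\<^sup>2 - 2 * Re (t * y) - 2 * Re (l n)"
          using x uV by (simp add: Q_def hnorm_power2_add mem_scale hnorm_scale ip_scale_left)
        finally have "m \<le> (cmod t * hnorm x)\<^sup>2 + 2 * Re (t * ip x (u n)) + (hnorm (u n))\<^sup>2 - 2 * Re (t * y) - 2 * Re (l n)" .
        moreover have "Re (t * (ip x (u n) - y)) = Re (t * ip x (u n)) - Re (t * y)"
          by (simp add: right_diff_distrib)
        ultimately show ?thesis using ul(2)[of n] by linarith
      qed
      then show "\<exists>N. \<forall>n\<ge>N. 0 \<le> 2 * Re (t * (ip x (u n) - y)) + (cmod t * hnorm x)\<^sup>2 + 1 / Suc n"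
        by blast
    qed
    \<comment> \<open>For \<open>t = - r * cnj d\<close> the linear term is
      \<open>- 2 r |d|^2\<close>, while the quadratic term is below \<open>r |d|^2\<close> unless
      \<open>d = 0\<close>. The \<open>+ 1\<close> covers \<open>hnorm x = 0\<close>.\<close>
    define r where "r = 1 / ((hnorm x)\<^sup>2 + 1)"
    have r: "0 < r" "r * (hnorm x)\<^sup>2 < 1"
      by (auto simp: r_def add_nonneg_pos)
    have e: "Re (- of_real r * cnj d * d) = - r * (cmod d)\<^sup>2"
      unfolding cmod_power2 by (simp add: power2_eq_square algebra_simps)
    have "0 \<le> 2 * (- r * (cmod d)\<^sup>2) + (r * cmod d * hnorm x)\<^sup>2"
      using key[of "- of_real r * cnj d"] r(1) unfolding e by (simp add: norm_mult)
    also have "\<dots> = r * (cmod d)\<^sup>2 * (r * (hnorm x)\<^sup>2 - 2)"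
      by (simp add: power2_eq_square algebra_simps)
    finally have "d = 0"
      using r by (auto simp: zero_le_mult_iff mult_le_0_iff)
    then show ?thesis by (simp add: d_def)
  qed
  \<comment> \<open>The vector \<open>v\<close> is only a limit of vectors from \<open>R\<close>, so
    the bound at \<open>u n\<close> is passed to the limit and gives
    \<open>(hnorm v)\<^sup>2 \<le> C * hnorm v\<close>. The sign of \<open>C\<close> is open, hence
    the alternative \<open>v = 0\<close>.\<close>
  have norm_v: "hnorm v \<le> C \<or> v = 0"
  proof -
    have "(hnorm v)\<^sup>2 \<le> C * hnorm v"
    proof (rule LIMSEQ_le)
      have c: "(\<lambda>n. ip v (u n)) \<longlonglongrightarrow> ip v v"
        by (rule tendsto_ip_right[OF uV v v lim])
      then show "(\<lambda>n. cmod (ip v (u n))) \<longlonglongrightarrow> (hnorm v)\<^sup>2"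
        using tendsto_norm[OF c] unfolding ip_self[OF v] norm_of_real by simp
      have "(\<lambda>n. hnorm (u n) - hnorm v) \<longlonglongrightarrow> 0"
      proof (rule Lim_null_comparison[OF always_eventually lim], rule allI)
        fix n
        have "hnorm (u n) \<le> hnorm (u n - v) + hnorm v" "hnorm v \<le> hnorm (u n - v) + hnorm (u n)"
          using hnorm_triangle[of "u n - v" v] hnorm_triangle[of "v - u n" "u n"] uV[of n] v
            hnorm_minus_commute[of v "u n"] by (simp_all add: mem_diff)
        then show "norm (hnorm (u n) - hnorm v) \<le> hnorm (u n - v)" by simp
      qed
      then have "(\<lambda>n. hnorm (u n)) \<longlonglongrightarrow> hnorm v"
        by (simp add: LIM_zero_iff)
      then show "(\<lambda>n. C * hnorm (u n)) \<longlonglongrightarrow> C * hnorm v"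
        by (intro tendsto_intros)
      have "cmod (ip v (u n)) \<le> C * hnorm (u n)" for n
        using bd[OF ul(1)[of n]] rep[OF ul(1)[of n]] ip_commute[OF v uV[of n]] by simp
      then show "\<exists>N. \<forall>n\<ge>N. cmod (ip v (u n)) \<le> C * hnorm (u n)" by blast
    qed
    then show ?thesis
      using hnorm_nonneg[OF v] hnorm_eq_0_iff[OF v] by (auto simp: power2_eq_square)
  qed
  have "u n \<in> fst ` R" for n
    by (rule image_eqI[OF _ ul(1)]) simp
  from that[OF v rep norm_v this lim] show ?thesis .
qed

text \<open>\<open>Riesz_relation\<close> on the graph of \<open>x \<mapsto> ip (T x) y\<close>
  gives existence and positive definiteness gives uniqueness, so the \<open>THE\<close> in
  \<open>hadjoint\<close> denotes the representing vector.\<close>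

lemma hadjoint_eq:
  assumes T: "\<And>x. x \<in> V \<Longrightarrow> T x \<in> V"
    and T_add: "\<And>x y. x \<in> V \<Longrightarrow> y \<in> V \<Longrightarrow> T (x + y) = T x + T y"
    and T_scale: "\<And>c x. x \<in> V \<Longrightarrow> T (scale c x) = scale c (T x)"
    and bd: "\<And>x. x \<in> V \<Longrightarrow> hnorm (T x) \<le> C * hnorm x"
    and y: "y \<in> V"
  shows "hadjoint T y \<in> V" "x \<in> V \<Longrightarrow> ip (T x) y = ip x (hadjoint T y)"
proof -
  define R where "R = {(x, ip (T x) y) | x. x \<in> V}"
  have T0: "T 0 = 0"
    using T_scale[OF mem_0, of 0] by simp
  obtain v where v: "v \<in> V" "\<And>x l. (x, l) \<in> R \<Longrightarrow> ip x v = l"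
  proof (rule Riesz_relation[of R "C * hnorm y"])
    show "(0, 0) \<in> R"
      using mem_0 y T0 by (force simp: R_def ip_zero_left)
    show "(u + u', l + l') \<in> R" if "(u, l) \<in> R" "(u', l') \<in> R" for u l u' l'
      using that T y by (auto simp: R_def mem_add T_add ip_add_left)
    show "(scale c u, c * l) \<in> R" if "(u, l) \<in> R" for u l c
      using that T y by (auto simp: R_def mem_scale T_scale ip_scale_left)
    show "u \<in> V" if "(u, l) \<in> R" for u l
      using that by (auto simp: R_def)
    show "cmod l \<le> C * hnorm y * hnorm u" if "(u, l) \<in> R" for u l
    proof -
      have u: "u \<in> V" and l: "l = ip (T u) y"
        using that by (auto simp: R_def)
      have "cmod l \<le> hnorm (T u) * hnorm y"
        unfolding l by (rule Cauchy_Schwarz[OF T[OF u] y])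
      also have "\<dots> \<le> C * hnorm u * hnorm y"
        by (rule mult_right_mono[OF bd[OF u] hnorm_nonneg[OF y]])
      finally show ?thesis by (simp add: mult_ac)
    qed
  qed blast
  let ?P = "\<lambda>z. z \<in> V \<and> (\<forall>x\<in>V. ip (T x) y = ip x z)"
  have P: "?P v"
    using v by (auto simp: R_def)
  have "z = v" if "?P z" for z
  proof -
    have d: "z - v \<in> V" using that v(1) by (simp add: mem_diff)
    then have "ip (z - v) (z - v) = 0"
      using that P v(1) ip_diff_right[OF d, of z v] by simp
    then show ?thesis
      using ip_pos[OF d] by fastforce
  qed
  with P have "?P (hadjoint T y)"
    unfolding hadjoint_def by (rule theI)
  then show "hadjoint T y \<in> V" "x \<in> V \<Longrightarrow> ip (T x) y = ip x (hadjoint T y)"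
    by auto
qed

end

section \<open>Multipliers and essential normality\<close>

lemma mult_op_add: "mult_op \<phi> (f + g) = mult_op \<phi> f + mult_op \<phi> g"
  by (auto simp: mult_op_def algebra_simps)

lemma mult_op_scale: "mult_op \<phi> (fun_scale c f) = fun_scale c (mult_op \<phi> f)"
  by (auto simp: mult_op_def fun_scale_def algebra_simps)

context rkhs
begin

section \<open>Membership in \<open>H\<close> by kernel domination, and contractive
  multipliers\<close>

definition kcomb :: "'x set \<Rightarrow> ('x \<Rightarrow> complex) \<Rightarrow> 'x \<Rightarrow> complex" where
  "kcomb F a = (\<Sum>w\<in>F. fun_scale (a w) (\<lambda>z. s z w))"

lemma kcomb_mem: "kcomb F a \<in> H"
  unfolding kcomb_def by (intro mem_sum mem_scale kernel_mem)

lemma kcomb_apply: "kcomb F a z = (\<Sum>w\<in>F. a w * s z w)"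
  unfolding kcomb_def by (induction F rule: infinite_finite_induct) (auto simp: fun_scale_def)

lemma ip_kcomb: "f \<in> H \<Longrightarrow> ip (kcomb F a) f = (\<Sum>w\<in>F. a w * cnj (f w))"
  unfolding kcomb_def
  by (simp add: ip_sum_left kernel_mem reproducing[of f] ip_commute[of _ f])

lemma kernel_eq_ip: "s z w = ip (\<lambda>x. s x w) (\<lambda>x. s x z)"
  by (rule reproducing[OF kernel_mem])

lemma kernel_herm: "s w z = cnj (s z w)"
  by (simp only: kernel_eq_ip[of w z] kernel_eq_ip[of z w] ip_commute[OF kernel_mem kernel_mem, of z w])

lemma psd_kernel: "psd s"
  using psd_transpose[OF psd_Gram[of "\<lambda>w z. s z w", OF kernel_mem]]
  by (simp add: kernel_eq_ip[symmetric])

lemma kernel_diag: "s z z = of_real ((hnorm (\<lambda>x. s x z))\<^sup>2)"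
  using ip_self[OF kernel_mem, of z] kernel_eq_ip[of z z] by simp

lemma Re_kernel_diag: "Re (s z z) = (hnorm (\<lambda>x. s x z))\<^sup>2"
  by (simp add: kernel_diag)

lemma eval_bound: "f \<in> H \<Longrightarrow> cmod (f z) \<le> hnorm f * sqrt (Re (s z z))"
  using Cauchy_Schwarz[OF _ kernel_mem, of f z]
  by (simp add: reproducing[symmetric] Re_kernel_diag hnorm_nonneg kernel_mem)

text \<open>Links positivity to boundedness: \<open>\<Sum>w\<in>F. cnj (c w) * cnj (f w)\<close> is
  the value at the kernel combination of the functional that \<open>f\<close> would represent. For
  \<open>C \<ge> 0\<close> the form is nonnegative exactly when that value is at most
  \<open>C\<close> times the norm.\<close>

lemma kernel_form:
  "(\<Sum>z\<in>F. \<Sum>w\<in>F. c z * cnj (c w) * (of_real (C\<^sup>2) * s z w - f z * cnj (f w)))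
     = of_real (C\<^sup>2 * (hnorm (kcomb F (\<lambda>w. cnj (c w))))\<^sup>2 - (cmod (\<Sum>w\<in>F. cnj (c w) * cnj (f w)))\<^sup>2)"
proof -
  let ?u = "kcomb F (\<lambda>w. cnj (c w))" and ?l = "\<Sum>w\<in>F. cnj (c w) * cnj (f w)"
  have "of_real ((hnorm ?u)\<^sup>2) = ip ?u ?u"
    by (rule ip_self[OF kcomb_mem, symmetric])
  also have "\<dots> = (\<Sum>z\<in>F. \<Sum>w\<in>F. c w * cnj (c z) * cnj (s z w))"
    by (simp add: ip_kcomb[OF kcomb_mem]) (simp add: kcomb_apply sum_distrib_left mult_ac)
  also have "\<dots> = (\<Sum>z\<in>F. \<Sum>w\<in>F. c z * cnj (c w) * s z w)"
    by (subst sum.swap) (simp add: kernel_herm[symmetric])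
  finally have 1: "of_real ((hnorm ?u)\<^sup>2) = \<dots>" .
  have "of_real ((cmod ?l)\<^sup>2) = ?l * cnj ?l"
    by (rule complex_norm_square)
  also have "\<dots> = (\<Sum>z\<in>F. \<Sum>w\<in>F. c z * cnj (c w) * (f z * cnj (f w)))"
    by (simp add: sum_product mult_ac)
  finally have 2: "of_real ((cmod ?l)\<^sup>2) = \<dots>" .
  show ?thesis
    unfolding of_real_diff of_real_mult 1 2
    by (simp add: sum_distrib_left sum_subtractf[symmetric] algebra_simps)
qed

text \<open>\<open>Riesz_relation\<close> is applied to the pairs of a kernel combination and the
  value prescribed by \<open>f\<close>. The representing vector agrees with \<open>f\<close> at
  every point, so membership of \<open>f\<close> is a conclusion; the minimising sequence supplies
  the approximation by kernel combinations.\<close>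

lemma kcomb_dense:
  assumes bd: "\<And>F a. finite F \<Longrightarrow> cmod (\<Sum>w\<in>F. a w * cnj (f w)) \<le> C * hnorm (kcomb F a)"
    and C: "0 \<le> C"
  obtains u where "f \<in> H" "hnorm f \<le> C" "\<And>n. \<exists>F a. finite F \<and> u n = kcomb F a"
    "(\<lambda>n. hnorm (u n - f)) \<longlonglongrightarrow> 0"
proof -
  define R where "R = {(kcomb F a, \<Sum>w\<in>F. a w * cnj (f w)) | F a. finite F}"
  have mem: "(kcomb F a, \<Sum>w\<in>F. a w * cnj (f w)) \<in> R" if "finite F" for F a
    using that by (auto simp: R_def)
  show ?thesis
  proof (rule Riesz_relation[of R C])
    show "(0, 0) \<in> R"
      using mem[of "{}"] by (simp add: kcomb_def)
    show "(u + u', l + l') \<in> R" if ul: "(u, l) \<in> R" "(u', l') \<in> R" for u l u' l'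
    proof -
      obtain F a where F: "finite F" "u = kcomb F a" "l = (\<Sum>w\<in>F. a w * cnj (f w))"
        using ul(1) by (auto simp: R_def)
      obtain F' a' where F': "finite F'" "u' = kcomb F' a'" "l' = (\<Sum>w\<in>F'. a' w * cnj (f w))"
        using ul(2) by (auto simp: R_def)
      \<comment> \<open>The two supports may overlap, so the coefficients are added on the
        union.\<close>
      define b where "b w = (if w \<in> F then a w else 0) + (if w \<in> F' then a' w else 0)" for w
      have split: "(\<Sum>w\<in>F \<union> F'. b w * g w) = (\<Sum>w\<in>F. a w * g w) + (\<Sum>w\<in>F'. a' w * g w)" for g
      proof -
        have "(\<Sum>w\<in>F \<union> F'. b w * g w)
            = (\<Sum>w\<in>F \<union> F'. if w \<in> F then a w * g w else 0) + (\<Sum>w\<in>F \<union> F'. if w \<in> F' then a' w * g w else 0)"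
          unfolding sum.distrib[symmetric] by (intro sum.cong) (auto simp: b_def algebra_simps)
        moreover have "(F \<union> F') \<inter> F = F" "(F \<union> F') \<inter> F' = F'" by auto
        ultimately show ?thesis
          using F(1) F'(1) by (simp add: sum.inter_restrict[symmetric])
      qed
      have "u + u' = kcomb (F \<union> F') b"
        by (rule ext) (simp add: F F' kcomb_apply split)
      then show ?thesis
        using mem[of "F \<union> F'" b] F F' by (simp add: split)
    qed
    show "(fun_scale c u, c * l) \<in> R" if ul: "(u, l) \<in> R" for u l c
    proof -
      obtain F a where F: "finite F" "u = kcomb F a" "l = (\<Sum>w\<in>F. a w * cnj (f w))"
        using ul by (auto simp: R_def)
      have "fun_scale c u = kcomb F (\<lambda>w. c * a w)"
        by (rule ext) (simp add: F kcomb_apply fun_scale_def sum_distrib_left mult_ac)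
      then show ?thesis
        using mem[OF F(1), of "\<lambda>w. c * a w"] F by (simp add: sum_distrib_left mult_ac)
    qed
    show "u \<in> H" if "(u, l) \<in> R" for u l
      using that kcomb_mem by (auto simp: R_def)
    show "cmod l \<le> C * hnorm u" if "(u, l) \<in> R" for u l
      using that bd by (auto simp: R_def)
    fix v u
    assume v: "v \<in> H" "\<And>x l. (x, l) \<in> R \<Longrightarrow> ip x v = l" "hnorm v \<le> C \<or> v = 0"
      and u: "\<And>n. u n \<in> fst ` R" "(\<lambda>n. hnorm (u n - v)) \<longlonglongrightarrow> 0"
    have "v = f"
    proof
      fix w
      have "ip (kcomb {w} (\<lambda>_. 1)) v = cnj (f w)"
        using v(2)[OF mem[of "{w}" "\<lambda>_. 1"]] by simp
      then show "v w = f w"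
        by (simp add: ip_kcomb[OF v(1)])
    qed
    moreover have "hnorm v \<le> C"
      using v(1,3) C hnorm_eq_0_iff[OF v(1)] by auto
    moreover have "\<exists>F a. finite F \<and> u n = kcomb F a" for n
      using u(1)[of n] unfolding R_def by fastforce
    ultimately show ?thesis
      using v(1) u(2) by (intro that[of u]) auto
  qed
qed

text \<open>Aronszajn's criterion: domination by the kernel bounds the functional attached to
  \<open>f\<close> on kernel combinations. The converse is \<open>psd_of_mem\<close>.\<close>

lemma mem_of_psd:
  assumes psd: "psd (\<lambda>z w. of_real (C\<^sup>2) * s z w - f z * cnj (f w))" and C: "0 \<le> C"
  shows "f \<in> H" "hnorm f \<le> C"
proof -
  have bd: "cmod (\<Sum>w\<in>F. a w * cnj (f w)) \<le> C * hnorm (kcomb F a)" if "finite F" for F a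
  proof (rule power2_le_imp_le)
    show "(cmod (\<Sum>w\<in>F. a w * cnj (f w)))\<^sup>2 \<le> (C * hnorm (kcomb F a))\<^sup>2"
      using psd_form[OF psd that, of "\<lambda>w. cnj (a w)"]
      unfolding kernel_form Re_complex_of_real by (simp add: power_mult_distrib)
  qed (simp add: C hnorm_nonneg kcomb_mem)
  show "f \<in> H" "hnorm f \<le> C"
    by (rule kcomb_dense[OF bd C]; assumption)+
qed

lemma cmod_ip_kcomb_le: "f \<in> H \<Longrightarrow> cmod (\<Sum>w\<in>F. a w * cnj (f w)) \<le> hnorm f * hnorm (kcomb F a)"
  using Cauchy_Schwarz[OF kcomb_mem, of f F a] by (simp add: ip_kcomb mult.commute)

lemma psd_of_mem:
  assumes f: "f \<in> H"
  shows "psd (\<lambda>z w. of_real ((hnorm f)\<^sup>2) * s z w - f z * cnj (f w))"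
proof (rule psdI)
  show "of_real ((hnorm f)\<^sup>2) * s w z - f w * cnj (f z) = cnj (of_real ((hnorm f)\<^sup>2) * s z w - f z * cnj (f w))" for z w
    using kernel_herm[of w z] by simp
  show "0 \<le> Re (\<Sum>z\<in>F. \<Sum>w\<in>F. c z * cnj (c w) * (of_real ((hnorm f)\<^sup>2) * s z w - f z * cnj (f w)))" for F c
    using power_mono[OF cmod_ip_kcomb_le[OF f, of "\<lambda>w. cnj (c w)" F], of 2]
    unfolding kernel_form Re_complex_of_real by (simp add: power_mult_distrib)
qed

text \<open>Kernel condition for multiplication by \<open>\<phi>\<close> to be a contraction of
  \<open>H\<close>. In this form products and pointwise limits are handled by algebra with
  kernels.\<close>

definition contractive :: "('x \<Rightarrow> complex) \<Rightarrow> bool" where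
  "contractive \<phi> \<longleftrightarrow> psd (\<lambda>z w. (1 - \<phi> z * cnj (\<phi> w)) * s z w)"

text \<open>The kernel that tests \<open>mult_op \<phi> f\<close> for norm at most
  \<open>hnorm f\<close> is a sum of two: \<open>(hnorm f)\<^sup>2\<close> times the contractivity
  kernel, and the \<open>\<phi>\<close>-congruence of the kernel that tests
  \<open>f\<close>.\<close>

lemma contractive_mult_op:
  assumes \<phi>: "contractive \<phi>" and f: "f \<in> H"
  shows "mult_op \<phi> f \<in> H" "hnorm (mult_op \<phi> f) \<le> hnorm f"
proof -
  have "psd (\<lambda>z w. of_real ((hnorm f)\<^sup>2) * ((1 - \<phi> z * cnj (\<phi> w)) * s z w)
      + \<phi> z * cnj (\<phi> w) * (of_real ((hnorm f)\<^sup>2) * s z w - f z * cnj (f w)))"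
    by (rule psd_add[OF psd_scale[OF \<phi>[unfolded contractive_def]] psd_congruence[OF psd_of_mem[OF f]]])
      simp
  then have "psd (\<lambda>z w. of_real ((hnorm f)\<^sup>2) * s z w - mult_op \<phi> f z * cnj (mult_op \<phi> f w))"
    by (simp add: mult_op_def algebra_simps)
  from mem_of_psd[OF this hnorm_nonneg[OF f]]
  show "mult_op \<phi> f \<in> H" "hnorm (mult_op \<phi> f) \<le> hnorm f" .
qed

section \<open>Essential normality tested on normalized kernel functions\<close>

lemma normalized_kernel_weakly_null:
  assumes y: "y \<in> H" and B: "\<And>z w. cmod (s z w) \<le> B w"
    and inf: "filterlim (\<lambda>n. Re (s (z n) (z n))) at_top sequentially"
  shows "(\<lambda>n. y (z n) / of_real (sqrt (Re (s (z n) (z n))))) \<longlonglongrightarrow> 0"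
proof (rule LIMSEQ_I)
  fix e :: real assume e: "0 < e"
  \<comment> \<open>Here \<open>y\<close> is split into a kernel combination, which \<open>B\<close>
    makes a bounded function, and a remainder of small norm. Dividing by the square root of the
    diagonal makes the first part small, and \<open>eval_bound\<close> controls the second.\<close>
  obtain u where u: "\<And>n. \<exists>F a. finite F \<and> u n = kcomb F a" "(\<lambda>n. hnorm (u n - y)) \<longlonglongrightarrow> 0"
    using kcomb_dense[OF cmod_ip_kcomb_le[OF y] hnorm_nonneg[OF y]] by metis
  obtain N where "norm (hnorm (u N - y) - 0) < e / 2"
    using LIMSEQ_D[OF u(2), of "e / 2"] e by auto
  moreover obtain F a where F: "finite F" "u N = kcomb F a"
    using u(1) by blast
  ultimately have small: "hnorm (y - kcomb F a) < e / 2"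
    using hnorm_minus_commute[OF y kcomb_mem] by auto
  define D where "D = (\<Sum>w\<in>F. cmod (a w) * B w)"
  have D: "cmod (kcomb F a x) \<le> D" for x
    unfolding kcomb_apply D_def by (rule order.trans[OF norm_sum]) (auto simp: norm_mult intro!: sum_mono mult_left_mono B)
  \<comment> \<open>The square yields \<open>D < e / 2 * sqrt S\<close>; the \<open>+ 1\<close>
    makes the inequality strict and \<open>S\<close> positive.\<close>
  obtain M where M: "\<And>n. n \<ge> M \<Longrightarrow> (2 * D / e)\<^sup>2 + 1 \<le> Re (s (z n) (z n))"
    using inf unfolding filterlim_at_top eventually_sequentially by blast
  show "\<exists>M. \<forall>n\<ge>M. norm (y (z n) / of_real (sqrt (Re (s (z n) (z n)))) - 0) < e"
  proof (intro exI allI impI)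
    fix n assume "M \<le> n"
    define S where "S = Re (s (z n) (z n))"
    have S: "(2 * D / e)\<^sup>2 < S"
      using M[OF \<open>M \<le> n\<close>] by (simp add: S_def)
    then have "2 * D / e < sqrt S"
      by (rule real_less_rsqrt)
    then have DS: "D < e / 2 * sqrt S"
      using e by (simp add: field_simps)
    have pos: "0 < S" using S by (rule le_less_trans[rotated]) simp
    have "cmod (y (z n)) \<le> cmod (kcomb F a (z n)) + cmod ((y - kcomb F a) (z n))"
      by (simp add: norm_triangle_sub)
    also have "\<dots> \<le> D + hnorm (y - kcomb F a) * sqrt S"
      unfolding S_def by (intro add_mono D eval_bound mem_diff y kcomb_mem)
    also have "\<dots> < e / 2 * sqrt S + e / 2 * sqrt S"
      using DS small pos by (intro add_strict_mono mult_strict_right_mono) auto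
    finally show "norm (y (z n) / of_real (sqrt (Re (s (z n) (z n)))) - 0) < e"
      using pos by (simp add: norm_divide S_def[symmetric] field_simps)
  qed
qed

lemma hadjoint_mult_op:
  assumes \<phi>: "contractive \<phi>" and y: "y \<in> H"
  shows "hadjoint (mult_op \<phi>) y \<in> H"
    "x \<in> H \<Longrightarrow> ip (mult_op \<phi> x) y = ip x (hadjoint (mult_op \<phi>) y)"
  using hadjoint_eq[of "mult_op \<phi>" 1 y] contractive_mult_op[OF \<phi>] y
  by (auto simp: mult_op_add mult_op_scale)

text \<open>Both the quadratic form at \<open>k\<close> and the squared norm of
  \<open>\<phi> k - \<phi>(z) k\<close> equal the squared norm of \<open>\<phi> k\<close> minus the
  squared modulus of \<open>\<phi>(z)\<close>. Point evaluation of that vector at \<open>w\<close>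
  gives the bound.\<close>

lemma self_commutator_bound:
  assumes \<phi>: "contractive \<phi>" and pos: "0 < Re (s z z)"
  defines "k \<equiv> fun_scale (of_real (1 / sqrt (Re (s z z)))) (\<lambda>x. s x z)"
  shows "(cmod (\<phi> w - \<phi> z))\<^sup>2 * (cmod (s w z))\<^sup>2
    \<le> Re (ip (hadjoint (mult_op \<phi>) (mult_op \<phi> k) - mult_op \<phi> (hadjoint (mult_op \<phi>) k)) k)
        * (Re (s z z) * Re (s w w))"
proof -
  let ?T = "mult_op \<phi>"
  let ?A = "hadjoint ?T"
  define S where "S = Re (s z z)"
  define c where "c = 1 / sqrt S"
  have S: "0 < S" "s z z = of_real S"
    using pos kernel_diag[of z] by (auto simp: S_def)
  have c: "0 < c" "c * (c * S) = 1"
    using S by (simp_all add: c_def)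
  have k_def': "k = fun_scale (of_real c) (\<lambda>x. s x z)"
    by (simp add: k_def c_def S_def)
  have kH: "k \<in> H"
    unfolding k_def by (intro mem_scale kernel_mem)
  have ip_k: "ip f k = of_real c * f z" if "f \<in> H" for f
    unfolding k_def' using that by (simp add: ip_scale_right kernel_mem reproducing[of f z])
  have k_app: "k x = of_real c * s x z" for x
    by (simp add: k_def' fun_scale_def)
  have norm_k: "(hnorm k)\<^sup>2 = 1"
    unfolding hnorm_power2[OF kH] ip_k[OF kH] k_app S(2) using c by (simp flip: of_real_mult)
  note T = contractive_mult_op(1)[OF \<phi>]
  note A = hadjoint_mult_op[OF \<phi>]
  \<comment> \<open>Testing against the kernel function at \<open>x\<close> moves the adjoint over
    to \<open>mult_op \<phi>\<close>, and pairing with \<open>k\<close> is a multiple of evaluation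
    at \<open>z\<close>.\<close>
  have Ak: "?A k x = cnj (\<phi> z) * k x" for x
  proof -
    have "?A k x = cnj (ip (\<lambda>y. s y x) (?A k))"
      using reproducing[OF A(1)[OF kH], of x] ip_commute[OF A(1)[OF kH] kernel_mem, of x] by simp
    also have "\<dots> = cnj (ip (?T (\<lambda>y. s y x)) k)"
      by (simp add: A(2)[OF kH kernel_mem])
    also have "\<dots> = cnj (\<phi> z) * k x"
      unfolding ip_k[OF T[OF kernel_mem]] by (simp add: k_app mult_op_def kernel_herm[of x z])
    finally show ?thesis .
  qed
  have "ip (?A (?T k) - ?T (?A k)) k = ip (?A (?T k)) k - ip (?T (?A k)) k"
    by (intro ip_diff_left T A kH)
  also have "ip (?A (?T k)) k = cnj (ip k (?A (?T k)))"
    by (intro ip_commute T A kH)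
  also have "\<dots> = of_real ((hnorm (?T k))\<^sup>2)"
    by (simp only: A(2)[OF T[OF kH] kH, symmetric] ip_self[OF T[OF kH]] complex_cnj_complex_of_real)
  also have "ip (?T (?A k)) k = \<phi> z * cnj (\<phi> z) * of_real (c * (c * S))"
    unfolding ip_k[OF T[OF A(1)[OF kH]]] by (simp add: mult_op_def Ak k_app S mult_ac)
  also have "\<dots> = of_real ((cmod (\<phi> z))\<^sup>2)"
    unfolding c complex_norm_square by simp
  finally have comm: "Re (ip (?A (?T k) - ?T (?A k)) k) = (hnorm (?T k))\<^sup>2 - (cmod (\<phi> z))\<^sup>2"
    by (simp only: minus_complex.sel Re_complex_of_real)
  let ?d = "?T k - fun_scale (\<phi> z) k"
  have dH: "?d \<in> H"
    by (intro mem_diff T mem_scale kH)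
  have "ip (?T k) (fun_scale (\<phi> z) k) = cnj (\<phi> z) * (\<phi> z * of_real (c * (c * S)))"
    unfolding ip_scale_right[OF T[OF kH] kH] ip_k[OF T[OF kH]] by (simp add: mult_op_def k_app S mult_ac)
  also have "\<dots> = of_real ((cmod (\<phi> z))\<^sup>2)"
    unfolding c complex_norm_square by simp
  finally have "(hnorm ?d)\<^sup>2 = (hnorm (?T k))\<^sup>2 - (cmod (\<phi> z))\<^sup>2"
    using norm_k by (simp add: hnorm_power2_diff T kH mem_scale hnorm_scale power_mult_distrib)
  then have d: "(hnorm ?d)\<^sup>2 = Re (ip (?A (?T k) - ?T (?A k)) k)"
    using comm by simp
  have "?d w = (\<phi> w - \<phi> z) * (of_real c * s w z)"
    by (simp add: mult_op_def fun_scale_def k_app algebra_simps)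
  then have "cmod (\<phi> w - \<phi> z) * (c * cmod (s w z)) \<le> hnorm ?d * sqrt (Re (s w w))"
    using eval_bound[OF dH, of w] c by (simp add: norm_mult)
  then have "(cmod (\<phi> w - \<phi> z) * (c * cmod (s w z)))\<^sup>2 \<le> (hnorm ?d * sqrt (Re (s w w)))\<^sup>2"
    using c by (intro power_mono) auto
  also have "\<dots> = (hnorm ?d)\<^sup>2 * Re (s w w)"
    by (simp add: power_mult_distrib kernel_diag)
  finally have "S * (cmod (\<phi> w - \<phi> z) * (c * cmod (s w z)))\<^sup>2 \<le> S * ((hnorm ?d)\<^sup>2 * Re (s w w))"
    using S by (intro mult_left_mono) auto
  moreover have "S * (cmod (\<phi> w - \<phi> z) * (c * cmod (s w z)))\<^sup>2 = (c * (c * S)) * ((cmod (\<phi> w - \<phi> z))\<^sup>2 * (cmod (s w z))\<^sup>2)"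
    by (simp add: power2_eq_square mult_ac)
  ultimately show ?thesis
    unfolding d c by (simp add: S_def mult_ac)
qed

text \<open>Along a subsequence the self-commutator applied to \<open>k n\<close> converges in norm
  to some \<open>y\<close>, and \<open>ip y (k n)\<close> tends to \<open>0\<close>, hence so does
  the quadratic form. The assumption \<open>close\<close> says that the normalized kernel functions
  have inner product of modulus at least \<open>1/2\<close>.\<close>

lemma essentially_normal_oscillation:
  assumes \<phi>: "contractive \<phi>" and en: "essentially_normal (mult_op \<phi>)"
    and B: "\<And>z w. cmod (s z w) \<le> B w"
    and pos: "\<And>z. 0 < Re (s z z)"
    and inf: "filterlim (\<lambda>n. Re (s (z n) (z n))) at_top sequentially"
    and close: "\<And>n. Re (s (z n) (z n)) * Re (s (w n) (w n)) \<le> 4 * (cmod (s (w n) (z n)))\<^sup>2"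
  obtains r :: "nat \<Rightarrow> nat" where "strict_mono r" "(\<lambda>n. \<phi> (w (r n)) - \<phi> (z (r n))) \<longlonglongrightarrow> 0"
proof -
  let ?T = "mult_op \<phi>"
  let ?C = "\<lambda>x. hadjoint ?T (?T x) - ?T (hadjoint ?T x)"
  define k where "k n = fun_scale (of_real (1 / sqrt (Re (s (z n) (z n))))) (\<lambda>x. s x (z n))" for n
  have kH: "k n \<in> H" for n
    unfolding k_def by (intro mem_scale kernel_mem)
  have norm_k: "hnorm (k n) = 1" for n
    using pos[of "z n"] hnorm_nonneg[OF kernel_mem, of "z n"]
    by (simp add: k_def hnorm_scale kernel_mem Re_kernel_diag norm_divide)
  have CH: "?C x \<in> H" if "x \<in> H" for x
    by (intro mem_diff hadjoint_mult_op[OF \<phi>] contractive_mult_op[OF \<phi>] that)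
  have ball: "k n \<in> metric.mcball 0 1" for n
    using kH[of n] norm_k[of n] hnorm_minus_commute[OF kH mem_0, of n] by (simp add: mem_0 hdist_def)
  let ?K = "metric.mtopology closure_of (?C ` metric.mcball 0 1)"
  have "?C ` metric.mcball 0 1 \<subseteq> ?K"
    using CH by (intro closure_of_subset) auto
  then have "range (\<lambda>n. ?C (k n)) \<subseteq> ?K"
    using ball by blast
  moreover have "compactin metric.mtopology ?K"
    using en unfolding essentially_normal_def compact_operator_def .
  ultimately obtain y r where r: "strict_mono r"
    and lim: "limitin metric.mtopology ((\<lambda>n. ?C (k n)) \<circ> r) y sequentially"
    unfolding metric.compactin_sequentially by blast
  have y: "y \<in> H" and lim': "(\<lambda>n. hnorm (?C (k (r n)) - y)) \<longlonglongrightarrow> 0"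
    using lim limitin_iff_hnorm[of "(\<lambda>n. ?C (k n)) \<circ> r" y] CH[OF kH] by (auto simp: o_def)
  have "(\<lambda>n. y (z (r n)) / of_real (sqrt (Re (s (z (r n)) (z (r n)))))) \<longlonglongrightarrow> 0"
    by (rule normalized_kernel_weakly_null[OF y B filterlim_compose[OF inf filterlim_subseq[OF r]]])
  moreover have "y (z n) / of_real (sqrt (Re (s (z n) (z n)))) = ip y (k n)" for n
    unfolding k_def using y by (simp add: ip_scale_right kernel_mem reproducing[of y "z n"])
  ultimately have "(\<lambda>n. hnorm (?C (k (r n)) - y) + cmod (ip y (k (r n)))) \<longlonglongrightarrow> 0"
    using tendsto_add[OF lim' tendsto_norm_zero] by force
  then have null: "(\<lambda>n. 4 * (hnorm (?C (k (r n)) - y) + cmod (ip y (k (r n))))) \<longlonglongrightarrow> 0"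
    using tendsto_mult_right_zero by blast
  have bound: "(cmod (\<phi> (w n) - \<phi> (z n)))\<^sup>2 \<le> 4 * (hnorm (?C (k n) - y) + cmod (ip y (k n)))" for n
  proof -
    let ?q = "Re (s (z n) (z n)) * Re (s (w n) (w n))"
    have q: "0 < ?q" using pos by simp
    have "ip (?C (k n) - y) (k n) = ip (?C (k n)) (k n) - ip y (k n)"
      by (rule ip_diff_left[OF CH[OF kH] y kH])
    then have le: "Re (ip (?C (k n)) (k n)) \<le> hnorm (?C (k n) - y) + cmod (ip y (k n))"
      using Re_ip_le[OF mem_diff[OF CH[OF kH] y] kH, of n n] complex_Re_le_cmod[of "ip y (k n)"]
      unfolding norm_k by (simp only: minus_complex.sel)
    have "(cmod (\<phi> (w n) - \<phi> (z n)))\<^sup>2 * ?q \<le> 4 * ((cmod (\<phi> (w n) - \<phi> (z n)))\<^sup>2 * (cmod (s (w n) (z n)))\<^sup>2)"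
      using mult_left_mono[OF close[of n], of "(cmod (\<phi> (w n) - \<phi> (z n)))\<^sup>2"] by simp
    also have "\<dots> \<le> 4 * (Re (ip (?C (k n)) (k n)) * ?q)"
      using self_commutator_bound[OF \<phi> pos, of "w n" "z n"] by (simp add: k_def)
    finally have "(cmod (\<phi> (w n) - \<phi> (z n)))\<^sup>2 * ?q \<le> 4 * Re (ip (?C (k n)) (k n)) * ?q"
      by (simp only: mult.assoc)
    then have "(cmod (\<phi> (w n) - \<phi> (z n)))\<^sup>2 \<le> 4 * Re (ip (?C (k n)) (k n))"
      using q by (rule mult_right_le_imp_le)
    also have "\<dots> \<le> 4 * (hnorm (?C (k n) - y) + cmod (ip y (k n)))"
      using le by (rule mult_left_mono) simp
    finally show ?thesis .
  qed
  have "(\<lambda>n. (cmod (\<phi> (w (r n)) - \<phi> (z (r n))))\<^sup>2) \<longlonglongrightarrow> 0"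
    by (rule tendsto_sandwich[OF always_eventually always_eventually tendsto_const null])
      (use bound in auto)
  then have "(\<lambda>n. \<phi> (w (r n)) - \<phi> (z (r n))) \<longlonglongrightarrow> 0"
    using tendsto_real_sqrt by (fastforce intro: tendsto_norm_zero_cancel)
  with r show ?thesis by (rule that)
qed

end

section \<open>Cayley products\<close>

text \<open>The ratio 1001 makes all terms below \<open>n\<close> together at most a thousandth of
  the \<open>n\<close>-th power.\<close>

lemma sum_powers_below: "(\<Sum>m<n. (1001::real) ^ m) \<le> 1001 ^ n / 1000"
  by (induction n) auto

lemma sum_powers_above:
  assumes "n \<le> N"
  shows "(\<Sum>m\<in>{n<..N}. (1 / 1001 :: real) ^ m) = ((1 / 1001) ^ n - (1 / 1001) ^ N) / 1000"
  using assms
proof (induction N rule: dec_induct)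
  case (step N)
  then have "{n<..Suc N} = insert (Suc N) {n<..N}" by auto
  then show ?case using step by simp
qed simp

text \<open>By geometric sums the terms before \<open>n\<close> and those after it contribute at
  most \<open>1001 ^ n / 500\<close> each.\<close>

lemma suminf_dominant_term:
  fixes f :: "nat \<Rightarrow> complex"
  assumes below: "\<And>m. m < n \<Longrightarrow> cmod (f m) \<le> 2 * 1001 ^ m"
    and above: "\<And>m. cmod (f (m + Suc n)) \<le> 2 * 1001 ^ n * (1 / 1001) ^ Suc m"
  shows "summable f" "cmod (suminf f - f n) \<le> 1001 ^ n / 250"
proof -
  have geo: "(\<lambda>m. 2 * 1001 ^ n / 1001 * (1 / 1001 :: real) ^ m) sums (2 * 1001 ^ n / 1001 * (1 / (1 - 1 / 1001)))"
    by (intro sums_mult geometric_sums) simp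
  have le: "cmod (f (m + Suc n)) \<le> 2 * 1001 ^ n / 1001 * (1 / 1001) ^ m" for m
    using above[of m] by simp
  have tail: "summable (\<lambda>m. cmod (f (m + Suc n)))"
    by (rule summable_comparison_test'[OF sums_summable[OF geo], of 0]) (use le in auto)
  then have "summable (\<lambda>m. f (m + Suc n))"
    by (rule summable_norm_cancel)
  then show f: "summable f"
    using summable_iff_shift[of f "Suc n"] by blast
  have "suminf f = (\<Sum>m. f (m + Suc n)) + (\<Sum>m<Suc n. f m)"
    by (rule suminf_split_initial_segment[OF f])
  then have "suminf f - f n = (\<Sum>m. f (m + Suc n)) + (\<Sum>m<n. f m)"
    by simp
  also have "cmod \<dots> \<le> cmod (\<Sum>m. f (m + Suc n)) + cmod (\<Sum>m<n. f m)"
    by (rule norm_triangle_ineq)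
  also have "cmod (\<Sum>m. f (m + Suc n)) \<le> (\<Sum>m. cmod (f (m + Suc n)))"
    by (rule summable_norm[OF tail])
  also have "\<dots> \<le> (\<Sum>m. 2 * 1001 ^ n / 1001 * (1 / 1001 :: real) ^ m)"
    by (rule suminf_le[OF le tail sums_summable[OF geo]])
  also have "\<dots> = 1001 ^ n / 500"
    using sums_unique[OF geo] by simp
  also have "cmod (\<Sum>m<n. f m) \<le> (\<Sum>m<n. 2 * 1001 ^ m)"
    by (rule order.trans[OF norm_sum sum_mono]) (use below in auto)
  also have "\<dots> \<le> 1001 ^ n / 500"
    using sum_powers_below[of n] by (simp add: sum_distrib_left[symmetric])
  finally show "cmod (suminf f - f n) \<le> 1001 ^ n / 250" by simp
qed

text \<open>Cayley transform from the closed right half-plane to the closed unit disc, scaled so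
  that its zero is \<open>1001 ^ m\<close>.\<close>

definition cayley :: "complex \<Rightarrow> nat \<Rightarrow> complex" where
  "cayley G m = (of_real (1001 ^ m) - G) / (of_real (1001 ^ m) + G)"

context
  fixes G :: complex
  assumes G: "0 \<le> Re G"
begin

lemma cayley_denom: "1001 ^ m \<le> cmod (of_real (1001 ^ m) + G)" "cmod G \<le> cmod (of_real (1001 ^ m) + G)"
proof -
  show "1001 ^ m \<le> cmod (of_real (1001 ^ m) + G)"
    using complex_Re_le_cmod[of "of_real (1001 ^ m) + G"] G by simp
  have "(Re G)\<^sup>2 \<le> (1001 ^ m + Re G)\<^sup>2"
    using G by (intro power_mono) auto
  then show "cmod G \<le> cmod (of_real (1001 ^ m) + G)"
    by (simp add: cmod_def)
qed

lemma cayley_denom_pos: "0 < cmod (of_real (1001 ^ m) + G)"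
  by (rule less_le_trans[OF _ cayley_denom(1)]) simp

lemma cayley_le_1: "cmod (cayley G m) \<le> 1"
proof -
  have "(1001 ^ m - Re G)\<^sup>2 \<le> (1001 ^ m + Re G)\<^sup>2"
    using G by (simp add: power2_sum power2_diff)
  then have "cmod (of_real (1001 ^ m) - G) \<le> cmod (of_real (1001 ^ m) + G)"
    by (simp add: cmod_def)
  then show ?thesis
    using cayley_denom_pos[of m] by (simp add: cayley_def norm_divide)
qed

text \<open>For the factors with \<open>1001 ^ m\<close> far above \<open>cmod G\<close>. The bound
  is summable over \<open>m\<close>, which makes the product converge.\<close>

lemma cayley_near_1: "cmod (cayley G m - 1) \<le> 2 * cmod G / 1001 ^ m"
proof -
  have "cayley G m - 1 = - (2 * G) / (of_real (1001 ^ m) + G)"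
    using cayley_denom_pos[of m] by (simp add: cayley_def field_simps)
  then have "cmod (cayley G m - 1) = 2 * cmod G / cmod (of_real (1001 ^ m) + G)"
    by (simp only: norm_divide norm_minus_cancel norm_mult norm_numeral)
  also have "\<dots> \<le> 2 * cmod G / 1001 ^ m"
    by (rule divide_left_mono[OF cayley_denom(1)]) (use cayley_denom_pos[of m] in auto)
  finally show ?thesis .
qed

text \<open>For the factors with \<open>1001 ^ m\<close> far below \<open>cmod G\<close>: they are
  close to \<open>-1\<close>, so their modulus is close to \<open>1\<close>.\<close>

lemma cayley_near_minus_1:
  assumes "G \<noteq> 0"
  shows "cmod (cayley G m + 1) \<le> 2 * 1001 ^ m / cmod G"
proof -
  have "cayley G m + 1 = of_real (2 * 1001 ^ m) / (of_real (1001 ^ m) + G)"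
    using cayley_denom_pos[of m] by (simp add: cayley_def field_simps)
  then have "cmod (cayley G m + 1) = 2 * 1001 ^ m / cmod (of_real (1001 ^ m) + G)"
    by (simp only: norm_divide norm_of_real) simp
  also have "\<dots> \<le> 2 * 1001 ^ m / cmod G"
    by (rule divide_left_mono[OF cayley_denom(2)]) (use cayley_denom_pos[of m] assms in auto)
  finally show ?thesis .
qed

text \<open>A factor vanishes if \<open>G\<close> is some \<open>1001 ^ m\<close>;
  \<open>convergent_prod\<close> admits finitely many zero factors, so this case is covered.\<close>

lemma cayley_prod_LIMSEQ: "(\<lambda>N. \<Prod>m\<le>N. cayley G m) \<longlonglongrightarrow> prodinf (cayley G)"
proof -
  have geo: "summable (\<lambda>m. 2 * cmod G * (1 / 1001) ^ m)"
    by (intro summable_mult summable_geometric) simp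
  have "summable (\<lambda>m. norm (cayley G m - 1))"
    by (rule summable_comparison_test'[OF geo, of 0]) (use cayley_near_1 in \<open>simp add: power_divide\<close>)
  then have "convergent_prod (cayley G)"
    by (intro abs_convergent_prod_imp_convergent_prod summable_imp_abs_convergent_prod)
  then show ?thesis
    by (rule convergent_prod_LIMSEQ)
qed

text \<open>The \<open>n\<close>-th factor alone is this small, and no other factor exceeds
  \<open>1\<close> in modulus.\<close>

lemma cayley_prod_small:
  assumes "cmod (G - of_real (1001 ^ n)) \<le> 1001 ^ n / 250"
  shows "cmod (prodinf (cayley G)) \<le> 1 / 250"
proof (rule LIMSEQ_le_const2[OF tendsto_norm[OF cayley_prod_LIMSEQ]], intro exI allI impI)
  fix N assume "n \<le> N"
  have "cmod (\<Prod>m\<le>N. cayley G m) = cmod (cayley G n) * (\<Prod>m\<in>{..N} - {n}. cmod (cayley G m))"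
    using \<open>n \<le> N\<close> by (simp add: prod.remove[of "{..N}" n] norm_mult prod_norm)
  also have "\<dots> \<le> cmod (cayley G n) * 1"
    by (intro mult_left_mono prod_le_1) (auto simp: cayley_le_1)
  also have "cmod (cayley G n) = cmod (G - of_real (1001 ^ n)) / cmod (of_real (1001 ^ n) + G)"
    by (simp only: cayley_def norm_divide norm_minus_commute)
  also have "\<dots> \<le> (1001 ^ n / 250) / 1001 ^ n"
    by (intro frac_le assms cayley_denom) auto
  finally show "cmod (\<Prod>m\<le>N. cayley G m) \<le> 1 / 250" by simp
qed

text \<open>The \<open>n\<close>-th factor has modulus at least \<open>1/4\<close>, the quotient of
  \<open>2/5\<close> by \<open>8/5\<close>. The defects of the others sum to at most
  \<open>2 * 20 / 1000 = 1/25\<close>, so the Weierstrass inequality leaves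
  \<open>1/4 * 24/25 > 1/5\<close>.\<close>

lemma cayley_prod_large:
  assumes lo: "1001 ^ n / 10 \<le> cmod G" and hi: "cmod G \<le> 3 / 5 * 1001 ^ n"
  shows "1 / 5 \<le> cmod (prodinf (cayley G))"
proof (rule LIMSEQ_le_const[OF tendsto_norm[OF cayley_prod_LIMSEQ]], intro exI allI impI)
  fix N assume N: "n \<le> N"
  define h where "h m = 1 - cmod (cayley G m)" for m
  have h01: "h m \<in> {0..1}" for m
    using cayley_le_1[of m] by (simp add: h_def)
  have pos: "0 < cmod G"
    using lo by (rule less_le_trans[rotated]) simp
  \<comment> \<open>The defect is bounded by the distance of the factor to \<open>-1\<close>, used
    for \<open>m < n\<close>, and in \<open>above\<close> by its distance to \<open>1\<close>, used
    for \<open>m > n\<close>.\<close>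
  have below: "h m \<le> 20 * 1001 ^ m / 1001 ^ n" for m
  proof -
    have "h m \<le> cmod (cayley G m + 1)"
      using norm_triangle_ineq4[of "cayley G m + 1" "cayley G m"] by (simp add: h_def)
    also have "\<dots> \<le> 2 * 1001 ^ m / cmod G"
      using pos by (intro cayley_near_minus_1) auto
    also have "\<dots> \<le> 2 * 1001 ^ m / (1001 ^ n / 10)"
      using pos by (intro divide_left_mono lo) auto
    finally show ?thesis by simp
  qed
  have above: "h m \<le> 20 * 1001 ^ n * (1 / 1001) ^ m" for m
  proof -
    have "h m \<le> cmod (cayley G m - 1)"
      using norm_triangle_ineq4[of "cayley G m" "cayley G m - 1"] by (simp add: h_def)
    also have "\<dots> \<le> 2 * cmod G / 1001 ^ m"
      by (rule cayley_near_1)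
    also have "\<dots> \<le> 20 * 1001 ^ n / 1001 ^ m"
    proof (rule divide_right_mono)
      have "0 \<le> (1001::real) ^ n" by simp
      with hi show "2 * cmod G \<le> 20 * 1001 ^ n" by linarith
    qed simp
    finally show ?thesis by (simp add: power_divide)
  qed
  have "sum h ({..N} - {n}) = sum h {..<n} + sum h {n<..N}"
    using N by (subst sum.union_disjoint[symmetric]) (auto intro: sum.cong)
  also have "sum h {..<n} \<le> (\<Sum>m<n. 20 * 1001 ^ m / 1001 ^ n)"
    by (intro sum_mono below)
  also have "\<dots> = 20 / 1001 ^ n * (\<Sum>m<n. 1001 ^ m)"
    by (simp add: sum_distrib_left)
  also have "\<dots> \<le> 20 / 1001 ^ n * (1001 ^ n / 1000)"
    by (intro mult_left_mono sum_powers_below) simp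
  also have "sum h {n<..N} \<le> (\<Sum>m\<in>{n<..N}. 20 * 1001 ^ n * (1 / 1001) ^ m)"
    by (intro sum_mono above)
  also have "\<dots> = 20 * 1001 ^ n * (\<Sum>m\<in>{n<..N}. (1 / 1001) ^ m)"
    by (rule sum_distrib_left[symmetric])
  also have "\<dots> \<le> 20 * 1001 ^ n * ((1 / 1001) ^ n / 1000)"
    unfolding sum_powers_above[OF N] by (intro mult_left_mono divide_right_mono) auto
  finally have sum: "sum h ({..N} - {n}) \<le> 1 / 25"
    by (simp add: power_divide)
  have "1 / 4 \<le> cmod (cayley G n)"
  proof -
    have "2 / 5 * 1001 ^ n \<le> cmod (of_real (1001 ^ n) - G)"
      using norm_triangle_ineq2[of "of_real (1001 ^ n)" G] hi by (simp add: norm_power)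
    moreover have "cmod (of_real (1001 ^ n) + G) \<le> 8 / 5 * 1001 ^ n"
      using norm_triangle_ineq[of "of_real (1001 ^ n)" G] hi by (simp add: norm_power)
    ultimately show ?thesis
      using cayley_denom_pos[of n] by (simp add: cayley_def norm_divide field_simps)
  qed
  then have "1 / 4 * (24 / 25) \<le> cmod (cayley G n) * (1 - sum h ({..N} - {n}))"
    using sum by (intro mult_mono) auto
  also have "\<dots> \<le> cmod (cayley G n) * (\<Prod>m\<in>{..N} - {n}. 1 - h m)"
    by (intro mult_left_mono Weierstrass_prod_ineq h01) simp
  also have "\<dots> = cmod (\<Prod>m\<le>N. cayley G m)"
    using N by (simp add: prod.remove[of "{..N}" n] norm_mult prod_norm h_def)
  finally show "1 / 5 \<le> cmod (\<Prod>m\<le>N. cayley G m)" by simp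
qed

end

section \<open>Construction of the multiplier\<close>

context rkhs
begin

text \<open>Kernel form of multiplication by \<open>G\<close> having nonnegative real part. It makes
  sense even if \<open>G\<close> is not a multiplier, and it passes to nonnegative multiples, sums
  and convergent series.\<close>

definition accretive :: "('x \<Rightarrow> complex) \<Rightarrow> bool" where
  "accretive G \<longleftrightarrow> psd (\<lambda>z w. (G z + cnj (G w)) * s z w)"

lemma accretive_Re:
  assumes "accretive G" "0 < Re (s z z)"
  shows "0 \<le> Re (G z)"
proof -
  have "Im (s z z) = 0"
    by (simp add: kernel_diag)
  then have "Re ((G z + cnj (G z)) * s z z) = 2 * (Re (G z) * Re (s z z))"
    by simp
  then show ?thesis
    using psd_diag[OF assms(1)[unfolded accretive_def], of z] assms(2) by (simp add: zero_le_mult_iff)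
qed

lemma accretive_scale:
  assumes "accretive G" "0 \<le> r"
  shows "accretive (\<lambda>z. of_real r * G z)"
  using psd_scale[OF assms(1)[unfolded accretive_def] assms(2)]
  by (simp add: accretive_def algebra_simps)

lemma accretive_sum:
  assumes "\<And>i. i \<in> I \<Longrightarrow> accretive (g i)"
  shows "accretive (\<lambda>z. \<Sum>i\<in>I. g i z)"
  using assms
proof (induction I rule: infinite_finite_induct)
  case (insert i I)
  then have "psd (\<lambda>z w. (g i z + cnj (g i w)) * s z w + ((\<Sum>i\<in>I. g i z) + cnj (\<Sum>i\<in>I. g i w)) * s z w)"
    unfolding accretive_def by (intro psd_add) auto
  with insert.hyps show ?case
    by (simp add: accretive_def algebra_simps)
qed (simp_all add: accretive_def psd_zero)

lemma accretive_suminf: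
  assumes "\<And>n. accretive (g n)" "\<And>z. summable (\<lambda>n. g n z)"
  shows "accretive (\<lambda>z. \<Sum>n. g n z)"
  unfolding accretive_def
proof (rule psd_limit)
  show "psd (\<lambda>z w. ((\<Sum>n<N. g n z) + cnj (\<Sum>n<N. g n w)) * s z w)" for N
    using accretive_sum[of "{..<N}" g] assms(1) by (simp add: accretive_def)
  show "(\<lambda>N. ((\<Sum>n<N. g n z) + cnj (\<Sum>n<N. g n w)) * s z w)
      \<longlonglongrightarrow> ((\<Sum>n. g n z) + cnj (\<Sum>n. g n w)) * s z w" for z w
    by (intro tendsto_intros summable_LIMSEQ assms(2))
qed

text \<open>With \<open>c = 1001 ^ m\<close> the contractivity kernel is \<open>2 * c\<close> times
  the accretivity kernel, under congruence by \<open>1 / (c + G z)\<close>.\<close>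

lemma contractive_cayley:
  assumes G: "accretive G" and pos: "\<And>z. 0 < Re (s z z)"
  shows "contractive (\<lambda>z. cayley (G z) m)"
proof -
  let ?c = "1001 ^ m :: real"
  define h where "h z = 1 / (of_real ?c + G z)" for z
  have ne: "of_real ?c + G z \<noteq> 0" for z
    using cayley_denom_pos[OF accretive_Re[OF G pos], of m z] by auto
  have "psd (\<lambda>z w. h z * cnj (h w) * (of_real (2 * ?c) * ((G z + cnj (G w)) * s z w)))"
    by (rule psd_congruence[OF psd_scale[OF G[unfolded accretive_def]]]) simp
  moreover have "h z * cnj (h w) * (of_real (2 * ?c) * ((G z + cnj (G w)) * s z w))
      = (1 - cayley (G z) m * cnj (cayley (G w) m)) * s z w" for z w
  proof -
    define C p q where "C = complex_of_real ?c" and "p = G z" and "q = cnj (G w)"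
    have "C + p \<noteq> 0"
      using ne[of z] by (simp add: C_def p_def)
    moreover have "C + q \<noteq> 0"
    proof -
      have "cnj (C + q) \<noteq> 0"
        using ne[of w] by (simp add: C_def q_def)
      then show ?thesis by (metis complex_cnj_zero)
    qed
    ultimately have "1 / (C + p) * (1 / (C + q)) * (2 * C * ((p + q) * s z w))
        = (1 - (C - p) / (C + p) * ((C - q) / (C + q))) * s z w"
      by (simp add: divide_simps) (simp add: algebra_simps)
    then show ?thesis
      by (simp add: h_def cayley_def C_def p_def q_def)
  qed
  ultimately show ?thesis
    by (simp only: contractive_def)
qed

text \<open>The kernel of the product is that of \<open>\<phi>\<close> plus the
  \<open>\<phi>\<close>-congruence of that of \<open>\<psi>\<close>.\<close>

lemma contractive_mult:
  assumes "contractive \<phi>" "contractive \<psi>"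
  shows "contractive (\<lambda>z. \<phi> z * \<psi> z)"
  using psd_add[OF assms(1)[unfolded contractive_def]
      psd_congruence[OF assms(2)[unfolded contractive_def], of \<phi>]]
  by (simp add: contractive_def algebra_simps)

lemma contractive_prod:
  assumes "\<And>i. i \<in> I \<Longrightarrow> contractive (\<phi> i)"
  shows "contractive (\<lambda>z. \<Prod>i\<in>I. \<phi> i z)"
  using assms
  by (induction I rule: infinite_finite_induct)
    (simp_all add: contractive_mult contractive_def[of "\<lambda>z. 1"] psd_zero)

lemma contractive_limit:
  assumes "\<And>n. contractive (\<phi> n)" "\<And>z. (\<lambda>n. \<phi> n z) \<longlonglongrightarrow> \<psi> z"
  shows "contractive \<psi>"
  unfolding contractive_def
  by (rule psd_limit[where k = "\<lambda>n z w. (1 - \<phi> n z * cnj (\<phi> n w)) * s z w"])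
    (use assms(1) in \<open>auto simp: contractive_def intro!: tendsto_intros assms(2)\<close>)

text \<open>At \<open>z n\<close> and \<open>w n\<close> the \<open>n\<close>-th term of the accretive series
  \<open>\<Sum>n. 1001 ^ n * s x (z n) / s (z n) (z n)\<close> dominates all others, so the Blaschke product in this
  series with zeros \<open>1001 ^ n\<close> almost vanishes at \<open>z n\<close> but not at \<open>w n\<close>.\<close>

lemma oscillating_contractive:
  assumes bd: "\<And>x y. cmod (s x y) \<le> 2 * Re (s x x)"
    and ge1: "\<And>x. 1 \<le> Re (s x x)"
    and acc: "\<And>y. accretive (\<lambda>x. s x y)"
    and lo: "\<And>n. Re (s (z n) (z n)) / 8 \<le> cmod (s (w n) (z n))"
    and hi: "\<And>n. cmod (s (w n) (z n)) \<le> Re (s (z n) (z n)) / 2"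
    and grow: "\<And>n x. x = z n \<or> x = w n \<Longrightarrow> 1001\<^sup>2 * Re (s x x) \<le> Re (s (z (Suc n)) (z (Suc n)))"
  obtains \<phi> where "contractive \<phi>" "\<And>n. cmod (\<phi> (z n)) \<le> 1 / 250" "\<And>n. 1 / 5 \<le> cmod (\<phi> (w n))"
proof -
  define S where "S x = Re (s x x)" for x
  have S1: "1 \<le> S x" for x
    using ge1 by (simp add: S_def)
  have Spos: "0 < S x" for x
    using S1[of x] by linarith
  have bd1: "cmod (s x y) \<le> 2 * S x" and bd2: "cmod (s x y) \<le> 2 * S y" for x y
    using bd[of x y] bd[of y x] kernel_herm[of x y] by (simp_all add: S_def)
  have grow': "(1001\<^sup>2) ^ Suc m * S x \<le> S (z (m + Suc n))" if "x = z n \<or> x = w n" for m n x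
  proof (induction m)
    case 0
    then show ?case using grow[OF that] by (simp add: S_def)
  next
    case (Suc m)
    have "1001\<^sup>2 * ((1001\<^sup>2) ^ Suc m * S x) \<le> 1001\<^sup>2 * S (z (m + Suc n))"
      using Suc by (intro mult_left_mono) auto
    also have "\<dots> \<le> S (z (Suc m + Suc n))"
      using grow[of "z (m + Suc n)" "m + Suc n"] by (simp add: S_def)
    finally show ?case by (simp add: mult.assoc)
  qed
  \<comment> \<open>The weight makes \<open>f (z n) n\<close> exactly \<open>1001 ^ n\<close>, the
    zero of the \<open>n\<close>-th Cayley factor.\<close>
  define f where "f x n = of_real (1001 ^ n / S (z n)) * s x (z n)" for x n
  have f1: "cmod (f x n) \<le> 2 * 1001 ^ n" for x n
    using mult_left_mono[OF bd2[of x "z n"], of "1001 ^ n / S (z n)"] Spos[of "z n"]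
    by (simp add: f_def norm_mult norm_divide norm_power)
  \<comment> \<open>Of the growth by \<open>1001\<^sup>2\<close> per index, one factor 1001 offsets
    the weights and the other gives geometric decay. The case \<open>y = x\<close> serves the
    dominant-term estimate, arbitrary \<open>y\<close> the summability at every point.\<close>
  have f2: "cmod (f y (m + Suc n)) \<le> 2 * 1001 ^ n * (1 / 1001) ^ Suc m * (S y / S x)"
    if x: "x = z n \<or> x = w n" for x y m n
  proof -
    have "cmod (f y (m + Suc n)) = 1001 ^ (m + Suc n) * cmod (s y (z (m + Suc n))) / S (z (m + Suc n))"
      using Spos[of "z (m + Suc n)"] by (simp add: f_def norm_mult norm_divide norm_power)
    also have "\<dots> \<le> 1001 ^ (m + Suc n) * (2 * S y) / ((1001\<^sup>2) ^ Suc m * S x)"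
      using Spos[of x] Spos[of y] by (intro frac_le mult_left_mono bd1 grow' x) auto
    also have "\<dots> = 2 * 1001 ^ n * (1 / 1001) ^ Suc m * (S y / S x)"
    proof -
      have "(1001\<^sup>2 :: real) ^ Suc m = 1001 ^ Suc m * 1001 ^ Suc m"
        by (simp only: power2_eq_square power_mult_distrib)
      moreover have "(1001::real) ^ (m + Suc n) = 1001 ^ Suc m * 1001 ^ n"
        by (simp add: power_add)
      ultimately show ?thesis
        using Spos[of x] by (simp only: power_one_over) (simp add: field_simps)
    qed
    finally show ?thesis .
  qed
  define G where "G x = suminf (f x)" for x
  have dom: "cmod (G x - f x n) \<le> 1001 ^ n / 250" if "x = z n \<or> x = w n" for x n
    unfolding G_def by (rule suminf_dominant_term(2)) (use f1 f2[OF that, of x] Spos[of x] in auto)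
  have summ: "summable (f x)" for x
  proof -
    have "summable (\<lambda>m. 2 * (1 / 1001) ^ Suc m * (S x / S (z 0)) :: real)"
      by (intro summable_mult2 summable_mult summable_Suc_iff[THEN iffD2] summable_geometric) simp
    then have "summable (\<lambda>m. f x (m + Suc 0))"
      by (rule summable_comparison_test'[of _ 0]) (use f2[of "z 0" 0 x] in simp)
    then show ?thesis
      using summable_iff_shift[of "f x" 1] by simp
  qed
  have "accretive (\<lambda>x. f x n)" for n
    unfolding f_def using Spos[of "z n"] by (intro accretive_scale acc) auto
  then have G: "accretive G"
    unfolding G_def by (intro accretive_suminf summ)
  have pos: "0 < Re (s x x)" for x
    using Spos by (simp add: S_def)
  note ReG = accretive_Re[OF G pos]
  define \<phi> where "\<phi> x = prodinf (cayley (G x))" for x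
  show ?thesis
  proof (rule that)
    show "contractive \<phi>"
    proof (rule contractive_limit)
      show "contractive (\<lambda>x. \<Prod>m\<le>N. cayley (G x) m)" for N
        by (intro contractive_prod contractive_cayley G pos)
      show "(\<lambda>N. \<Prod>m\<le>N. cayley (G x) m) \<longlonglongrightarrow> \<phi> x" for x
        unfolding \<phi>_def by (rule cayley_prod_LIMSEQ[OF ReG])
    qed
    fix n
    have "s (z n) (z n) = of_real (S (z n))"
      by (simp add: S_def kernel_diag)
    then have fz: "f (z n) n = of_real (1001 ^ n)"
      using Spos[of "z n"] by (simp add: f_def)
    then show "cmod (\<phi> (z n)) \<le> 1 / 250"
      unfolding \<phi>_def using dom[of "z n" n] by (intro cayley_prod_small[OF ReG]) simp
    have fw: "cmod (f (w n) n) = 1001 ^ n * (cmod (s (w n) (z n)) / S (z n))"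
      using Spos[of "z n"] by (simp add: f_def norm_mult norm_divide norm_power)
    \<comment> \<open>Up to the error \<open>1001 ^ n / 250\<close> this places
      \<open>cmod (G (w n))\<close> between \<open>1001 ^ n / 10\<close> and
      \<open>3 / 5 * 1001 ^ n\<close>, the window of \<open>cayley_prod_large\<close>.\<close>
    have "1 / 8 \<le> cmod (s (w n) (z n)) / S (z n)" "cmod (s (w n) (z n)) / S (z n) \<le> 1 / 2"
      using lo[of n] hi[of n] Spos[of "z n"] by (simp_all add: S_def field_simps)
    then have "1001 ^ n * (1 / 8) \<le> cmod (f (w n) n)" "cmod (f (w n) n) \<le> 1001 ^ n * (1 / 2)"
      unfolding fw by (intro mult_left_mono; simp)+
    moreover have "cmod (f (w n) n) \<le> cmod (G (w n)) + 1001 ^ n / 250"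
      "cmod (G (w n)) \<le> cmod (f (w n) n) + 1001 ^ n / 250"
      using dom[of "w n" n] norm_triangle_sub[of "f (w n) n" "G (w n)"] norm_triangle_sub[of "G (w n)" "f (w n) n"]
      by (auto simp: norm_minus_commute)
    moreover have "0 < (1001::real) ^ n" by simp
    ultimately show "1 / 5 \<le> cmod (\<phi> (w n))"
      unfolding \<phi>_def by (intro cayley_prod_large[OF ReG, of n]) linarith+
  qed
qed

section \<open>Consequences of the complete Pick form of the kernel\<close>

lemma pick_kernel_properties:
  assumes "normalized_complete_pick_kernel scaleK K ipK s"
  shows "cmod (s z w) \<le> 2 * Re (s z z)" "1 \<le> Re (s z z)" "accretive (\<lambda>x. s x w)"
    "\<exists>w0. \<forall>z. s z w0 = 1"
proof -
  interpret K: complex_hilbert_space scaleK K ipK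
    using assms by (simp add: normalized_complete_pick_kernel_def)
  obtain b w0 where b: "\<And>z. b z \<in> K" "\<And>z. K.hnorm (b z) < 1" "b w0 = 0"
    and s_eq: "\<And>z w. s z w = 1 / (1 - ipK (b z) (b w))"
    using assms unfolding normalized_complete_pick_kernel_def by blast
  have diag: "Re (s z z) = 1 / (1 - (K.hnorm (b z))\<^sup>2)" for z
  proof -
    have "s z z = of_real (1 / (1 - (K.hnorm (b z))\<^sup>2))"
      unfolding s_eq K.ip_self[OF b(1)] by simp
    then show ?thesis by (simp only: Re_complex_of_real)
  qed
  have r: "0 \<le> K.hnorm (b z)" "(K.hnorm (b z))\<^sup>2 < 1" for z
    using K.hnorm_nonneg[OF b(1)] b(2) by (auto simp: power_less_one_iff abs_square_less_1)
  show "1 \<le> Re (s z z)"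
    unfolding diag using r[of z] by simp
  have ip_le: "cmod (ipK (b z) (b w)) \<le> K.hnorm (b z)" for z w
    using K.Cauchy_Schwarz[OF b(1) b(1), of z w] mult_left_mono[OF less_imp_le[OF b(2)[of w]] r(1)[of z]]
    by simp
  have den: "1 - K.hnorm (b z) \<le> cmod (1 - ipK (b z) (b w))" for z w
    using ip_le[of z w] norm_triangle_ineq2[of 1 "ipK (b z) (b w)"] by simp
  have ne: "1 - ipK (b z) (b w) \<noteq> 0" for z w
    using den[of z w] b(2)[of z] by auto
  show "cmod (s z w) \<le> 2 * Re (s z z)"
  proof -
    \<comment> \<open>Cauchy-Schwarz bounds the kernel by \<open>1 / (1 - q)\<close>; expanding by
      \<open>1 + q < 2\<close> compares this with the diagonal value
      \<open>1 / (1 - q\<^sup>2)\<close>.\<close>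
    define q where "q = K.hnorm (b z)"
    have q: "0 \<le> q" "q < 1"
      using r(1) b(2) by (auto simp: q_def)
    have "cmod (s z w) = 1 / cmod (1 - ipK (b z) (b w))"
      by (simp add: s_eq norm_divide)
    also have "\<dots> \<le> 1 / (1 - q)"
      using den[of z w] q ne[of z w] by (intro divide_left_mono mult_pos_pos) (auto simp: q_def)
    also have "\<dots> = (1 + q) / (1 - q\<^sup>2)"
    proof -
      have "1 - q\<^sup>2 = (1 - q) * (1 + q)"
        by (simp add: power2_eq_square algebra_simps)
      then show ?thesis using q by simp
    qed
    also have "\<dots> \<le> 2 / (1 - q\<^sup>2)"
      using q r(2)[of z] by (intro divide_right_mono) (auto simp: q_def)
    finally show ?thesis by (simp add: diag q_def)
  qed
  show "\<exists>w0. \<forall>z. s z w0 = 1"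
    using b(1) by (intro exI[of _ w0]) (simp add: s_eq b(3) K.ip_zero_right)
  show "accretive (\<lambda>x. s x w)" for w
  proof -
    define \<beta> where "\<beta> z = ipK (b z) (b w)" for z
    \<comment> \<open>Schur product of \<open>s\<close> with the Gram kernel of \<open>b\<close>
      deflated along \<open>b w\<close>, a vector of norm below \<open>1\<close>.\<close>
    have "psd (\<lambda>x y. (ipK (b x) (b y) - \<beta> x * cnj (\<beta> y)) * s x y)"
      unfolding \<beta>_def by (intro psd_mult K.psd_Gram_deflate psd_kernel b less_imp_le)
    then have "psd (\<lambda>x y. s x w * cnj (s y w) * (1 + (ipK (b x) (b y) - \<beta> x * cnj (\<beta> y)) * s x y) + s x y)"
      by (rule psd_add[OF psd_congruence[OF psd_add[OF psd_one]] psd_kernel])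
    \<comment> \<open>With \<open>p\<close>, \<open>q\<close>, \<open>t\<close> as below,
      \<open>1/(1-p) + 1/(1-q) - 1 = (1 - p q) / ((1-p) (1-q))\<close> and
      \<open>(1 - p q) / (1-t) = 1 + (t - p q) / (1-t)\<close>.\<close>
    moreover have "s x w * cnj (s y w) * (1 + (ipK (b x) (b y) - \<beta> x * cnj (\<beta> y)) * s x y) + s x y
        = (s x w + cnj (s y w)) * s x y" for x y
    proof -
      define p q t where "p = \<beta> x" and "q = cnj (\<beta> y)" and "t = ipK (b x) (b y)"
      have "1 - p \<noteq> 0" "1 - t \<noteq> 0"
        using ne by (auto simp: p_def t_def \<beta>_def)
      moreover have "1 - q \<noteq> 0"
        using ne[of y w] complex_cnj_cancel_iff[of "\<beta> y" 1] by (auto simp: q_def \<beta>_def)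
      ultimately have "1 / (1 - p) * (1 / (1 - q)) * (1 + (t - p * q) * (1 / (1 - t))) + 1 / (1 - t)
          = (1 / (1 - p) + 1 / (1 - q)) * (1 / (1 - t))"
        by (simp add: divide_simps) (simp add: algebra_simps)
      then show ?thesis
        by (simp add: s_eq p_def q_def t_def \<beta>_def)
    qed
    ultimately show ?thesis
      by (simp only: accretive_def)
  qed
qed

end

section \<open>Pairs of prescribed normalized overlap, from connectedness\<close>

lemma exists_close_pair:
  fixes s :: "'x::topological_space \<Rightarrow> 'x \<Rightarrow> complex"
  assumes conn: "connected (UNIV :: 'x set)"
    and cont: "continuous_on UNIV (\<lambda>(z, w). s z w)"
    and unb: "\<not> bounded (range (\<lambda>(z, w). s z w))"
    and herm: "\<And>z w. cmod (s z w) = cmod (s w z)"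
    and bd: "\<And>z w. cmod (s z w) \<le> 2 * Re (s z z)"
    and ge1: "\<And>z. 1 \<le> Re (s z z)"
    and w0: "\<And>z. s z w0 = 1"
  obtains z w where "M \<le> Re (s z z)" "4 * (cmod (s w z))\<^sup>2 = Re (s z z) * Re (s w w)"
    "Re (s z z) / 8 \<le> cmod (s w z)" "cmod (s w z) \<le> Re (s z z) / 2"
proof -
  \<comment> \<open>The bound \<open>bd\<close> turns unboundedness of \<open>s\<close> into a large
    diagonal value. The \<open>5\<close> ensures
    \<open>F w0 = 4 - Re (s z z) \<le> 0\<close>.\<close>
  obtain z where z: "max M 5 < Re (s z z)"
  proof -
    have "\<exists>p\<in>range (\<lambda>(z, w). s z w). \<not> cmod p \<le> 2 * max M 5"
      using unb unfolding bounded_iff by blast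
    then obtain z w where "2 * max M 5 < cmod (s z w)"
      by (metis (mono_tags, lifting) case_prod_beta imageE not_le)
    with bd[of z w] that[of z] show ?thesis by linarith
  qed
  \<comment> \<open>At a zero of \<open>F\<close> the normalized kernel functions have inner product
    of modulus \<open>1/2\<close>. Connectedness yields a zero, since \<open>F\<close> is
    nonpositive at \<open>w0\<close> and nonnegative at \<open>z\<close>.\<close>
  define F where "F x = 4 * (cmod (s x z))\<^sup>2 - Re (s z z) * Re (s x x)" for x
  have c1: "continuous_on UNIV (\<lambda>x. s x z)"
    using continuous_on_compose2[OF cont, of UNIV "\<lambda>x. (x, z)"]
    by (simp add: continuous_on_Pair continuous_on_id continuous_on_const)
  have c2: "continuous_on UNIV (\<lambda>x. s x x)"
    using continuous_on_compose2[OF cont, of UNIV "\<lambda>x. (x, x)"]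
    by (simp add: continuous_on_Pair continuous_on_id)
  have "connected (range F)"
    unfolding F_def by (intro connected_continuous_image conn continuous_intros c1 c2)
  moreover have "F w0 \<le> 0"
    using z w0[of z] w0[of w0] herm[of w0 z] by (simp add: F_def)
  moreover have "0 \<le> F z"
  proof -
    have "(Re (s z z))\<^sup>2 \<le> (cmod (s z z))\<^sup>2"
      using ge1[of z] by (intro power_mono complex_Re_le_cmod) auto
    then show ?thesis
      using zero_le_power2[of "cmod (s z z)"] unfolding F_def power2_eq_square by linarith
  qed
  ultimately have "0 \<in> range F"
    using connectedD_interval[of "range F" "F w0" "F z" 0] by simp
  then obtain w where w: "4 * (cmod (s w z))\<^sup>2 = Re (s z z) * Re (s w w)"
    by (auto simp: F_def)
  define a A B where "a = cmod (s w z)" and "A = Re (s z z)" and "B = Re (s w w)"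
  have eq: "4 * (a * a) = A * B"
    using w by (simp add: a_def A_def B_def power2_eq_square)
  have AB: "1 \<le> A" "1 \<le> B" "a \<le> 2 * A" "a \<le> 2 * B" "0 \<le> a" "M \<le> A"
    using ge1 bd[of z w] bd[of w z] herm[of z w] z by (auto simp: a_def A_def B_def)
  have "0 < A * B"
    using AB by simp
  with eq AB have a: "0 < a"
    by (cases "a = 0") auto
  \<comment> \<open>From \<open>a \<le> 2 * B\<close> follows
    \<open>A * a \<le> 2 * A * B = 8 * a\<^sup>2\<close>, and symmetrically for
    \<open>B\<close>.\<close>
  have lo: "A \<le> 8 * a" "B \<le> 8 * a"
  proof -
    have "A * a \<le> A * (2 * B)" "B * a \<le> B * (2 * A)"
      using AB by (intro mult_left_mono; simp)+
    then have "A * a \<le> (8 * a) * a" "B * a \<le> (8 * a) * a"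
      using eq by (simp_all add: mult_ac)
    with a show "A \<le> 8 * a" "B \<le> 8 * a"
      by (auto intro: mult_right_le_imp_le)
  qed
  show ?thesis
  \<comment> \<open>Since \<open>A * B = (2 * a)\<^sup>2\<close>, one of \<open>A\<close> and
    \<open>B\<close> is at least \<open>2 * a\<close>; its point becomes the first of the pair.
    After a swap \<open>M \<le> A < B\<close> keeps the lower bound.\<close>
  proof (cases "2 * a \<le> A")
    case True
    with that[of z w] w lo AB show ?thesis
      by (simp add: a_def A_def B_def)
  next
    case False
    have "2 * a \<le> B"
    proof (rule ccontr)
      assume "\<not> 2 * a \<le> B"
      with False AB have "A * B < (2 * a) * (2 * a)"
        by (intro mult_strict_mono) auto
      with eq show False by simp
    qed
    with False that[of w z] w lo AB herm[of z w] show ?thesis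
      by (simp add: a_def A_def B_def mult.commute)
  qed
qed

theorem proposition5p4:
  fixes H :: "('x::topological_space \<Rightarrow> complex) set"
    and ip :: "('x \<Rightarrow> complex) \<Rightarrow> ('x \<Rightarrow> complex) \<Rightarrow> complex"
    and s :: "'x \<Rightarrow> 'x \<Rightarrow> complex"
    and scaleK :: "complex \<Rightarrow> 'k::ab_group_add \<Rightarrow> 'k"
    and K :: "'k set"
    and ipK :: "'k \<Rightarrow> 'k \<Rightarrow> complex"
  assumes "connected (UNIV :: 'x set)"
    and "rkhs H ip s"
    and "normalized_complete_pick_kernel scaleK K ipK s"
    and "continuous_on UNIV (\<lambda>(z, w). s z w)"
    and "\<not> bounded (range (\<lambda>(z, w). s z w))"
  shows "\<exists>\<phi>\<in>Mult H. \<not> complex_hilbert_space.essentially_normal H ip (mult_op \<phi>)"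
proof -
  interpret rkhs H ip s
    by (rule assms(2))
  note pick = pick_kernel_properties[OF assms(3)]
  obtain w0 where w0: "\<And>z. s z w0 = 1"
    using pick(4) by blast
  have herm: "cmod (s z w) = cmod (s w z)" for z w
    using kernel_herm[of z w] by simp
  define P where "P = (\<lambda>(z, w). 4 * (cmod (s w z))\<^sup>2 = Re (s z z) * Re (s w w) \<and>
    Re (s z z) / 8 \<le> cmod (s w z) \<and> cmod (s w z) \<le> Re (s z z) / 2)"
  have ex: "\<exists>p. P p \<and> M \<le> Re (s (fst p) (fst p))" for M
    by (rule exists_close_pair[OF assms(1,4,5) herm pick(1,2) w0, of M]) (auto simp: P_def)
  \<comment> \<open>Dependent choice: the first diagonal value of the next pair is at least
    \<open>1001\<^sup>2\<close> times both diagonal values of the current pair.\<close>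
  have "\<exists>p. \<forall>n. P (p n) \<and> 1001\<^sup>2 * max (Re (s (fst (p n)) (fst (p n)))) (Re (s (snd (p n)) (snd (p n))))
      \<le> Re (s (fst (p (Suc n))) (fst (p (Suc n))))"
    by (rule dependent_nat_choice) (use ex in blast)+
  then obtain p where p: "\<And>n. P (p n)"
    "\<And>n. 1001\<^sup>2 * max (Re (s (fst (p n)) (fst (p n)))) (Re (s (snd (p n)) (snd (p n))))
      \<le> Re (s (fst (p (Suc n))) (fst (p (Suc n))))"
    by blast
  define z w where "z n = fst (p n)" and "w n = snd (p n)" for n
  have zw: "4 * (cmod (s (w n) (z n)))\<^sup>2 = Re (s (z n) (z n)) * Re (s (w n) (w n))"
    "Re (s (z n) (z n)) / 8 \<le> cmod (s (w n) (z n))" "cmod (s (w n) (z n)) \<le> Re (s (z n) (z n)) / 2" for n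
    using p(1)[of n] by (auto simp: P_def z_def w_def split_beta)
  have grow: "1001\<^sup>2 * Re (s x x) \<le> Re (s (z (Suc n)) (z (Suc n)))" if "x = z n \<or> x = w n" for n x
    using p(2)[of n] that by (auto simp: z_def w_def)
  obtain \<phi> where \<phi>: "contractive \<phi>" "\<And>n. cmod (\<phi> (z n)) \<le> 1 / 250" "\<And>n. 1 / 5 \<le> cmod (\<phi> (w n))"
    using oscillating_contractive[of z w, OF pick(1-3) zw(2,3) grow] by metis
  have inf: "filterlim (\<lambda>n. Re (s (z n) (z n))) at_top sequentially"
  proof (rule filterlim_at_top_mono[OF filterlim_real_sequentially always_eventually], rule allI)
    show "real n \<le> Re (s (z n) (z n))" for n
    proof (induction n)
      case 0
      then show ?case using pick(2)[of "z 0"] by simp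
    next
      case (Suc n)
      then show ?case using grow[of "z n" n] pick(2)[of "z n"] by simp
    qed
  qed
  have pos: "0 < Re (s x x)" for x
    using pick(2)[of x] by linarith
  have "\<phi> \<in> Mult H"
    using contractive_mult_op(1)[OF \<phi>(1)] by (simp add: Mult_def)
  moreover have "\<not> essentially_normal (mult_op \<phi>)"
  proof
    assume "essentially_normal (mult_op \<phi>)"
    then obtain r :: "nat \<Rightarrow> nat" where "(\<lambda>n. \<phi> (w (r n)) - \<phi> (z (r n))) \<longlonglongrightarrow> 0"
    proof (rule essentially_normal_oscillation[OF \<phi>(1) _ _ pos inf])
      show "cmod (s x y) \<le> 2 * Re (s y y)" for x y
        using pick(1)[of y x] herm[of x y] by simp
      show "Re (s (z n) (z n)) * Re (s (w n) (w n)) \<le> 4 * (cmod (s (w n) (z n)))\<^sup>2" for n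
        using zw(1)[of n] by simp
    qed blast
    \<comment> \<open>Every such difference has modulus at least \<open>1/5 - 1/250 > 1/10\<close>,
      so no subsequence can tend to \<open>0\<close>.\<close>
    then obtain n where "cmod (\<phi> (w (r n)) - \<phi> (z (r n))) < 1 / 10"
      using LIMSEQ_D[of _ 0 "1 / 10"] by fastforce
    then show False
      using norm_triangle_ineq2[of "\<phi> (w (r n))" "\<phi> (z (r n))"] \<phi>(2)[of "r n"] \<phi>(3)[of "r n"] by linarith
  qed
  ultimately show ?thesis by blast
qed

end
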